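(* Let $(V,\|\cdot\|)$ be a real Banach space whose dual $V^*$ has the Radon–Nikodým property, let $\Psi:V\to[0,+\infty)$ be a convex $C^1$ functional whose convex conjugate $\Psi^*$ is also $C^1$ on $V^*$, and let $\Phi:V\to(-\infty,+\infty]$ be proper, lower semicontinuous and $\lambda$-convex for $\Psi$ for some $\lambda\in\mathbb R$. Assume that there exist $\alpha>1$ and $C_\alpha>0$ such that $\|y-x\|^\alpha\le C_\alpha D_\Psi(y,x)$ for all $x,y\in V$, and that there exists a continuous function $g:(0,+\infty)\to(0,+\infty)$ with $g(0):=\lim_{r\to0}g(r)=+\infty$ and $g(\|\varphi\|+\|\psi\|)\,\|\varphi-\psi\|^2\le D_{\Psi^*}(\varphi,\psi)$ for all $\varphi,\psi\in V^*$ (with $\infty\cdot0:=0$). Let $(x_t)_{t\ge0}$ be a $\Psi$-mirror flow for $\Phi$. Then $$-\frac{d}{dt}\Phi(x_t)\ \ge\ g\big(2\|\nabla\Psi(x_t)\|\big)\,\Big\|\frac{d}{dt}\nabla\Psi(x_t)\Big\|^2\qquad\text{for Lebesgue-a.e. }t>0 .$$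
   Context: $\nabla\Psi:V\to V^*$ and $\nabla\Psi^*$ are the Fréchet derivatives; $\Psi^*(\varphi)=\sup_{x\in V}(\langle\varphi,x\rangle-\Psi(x))$. Bregman divergences: $D_\Psi(x,y):=\Psi(x)-\Psi(y)-\langle\nabla\Psi(y),x-y\rangle$ for $x,y\in V$, and $D_{\Psi^*}(\varphi,\psi):=\Psi^*(\varphi)-\Psi^*(\psi)-\langle\nabla\Psi^*(\psi),\varphi-\psi\rangle$ for $\varphi,\psi\in V^*$. $\Phi$ is $\lambda$-convex for $\Psi$ if $\Phi-\lambda\Psi$ is convex. Proper means $\Phi\not\equiv+\infty$. The Fréchet subdifferential at $x$ with $\Phi(x)<+\infty$ is $\partial_F\Phi(x):=\{\xi\in V^*:\liminf_{y\to x}\frac{\Phi(y)-\Phi(x)-\langle\xi,y-x\rangle}{\|y-x\|}\ge0\}$ (empty if $\Phi(x)=+\infty$). A $\Psi$-mirror flow for $\Phi$ is a map $t\in[0,+\infty)\mapsto x_t\in V$ such that $t\mapsto\nabla\Psi(x_t)\in V^*$ is locally absolutely continuous (there is $A\in L^1_{\rm loc}([0,+\infty))$ with $\|\nabla\Psi(x_t)-\nabla\Psi(x_s)\|\le\int_s^tA(r)\,dr$ for $0\le s\le t$) and $\frac{d}{dt}\nabla\Psi(x_t)\in-\partial_F\Phi(x_t)$ for Lebesgue-a.e. $t>0$. Part of the assertion is that $t\mapsto\Phi(x_t)$ is differentiable at a.e. $t>0$. *)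

theory Defs
  imports "HOL-Analysis.Analysis"
begin

text \<open>
  The dual space \<open>V\<^sup>*\<close> of \<open>'a\<close> is the type \<open>'a \<Rightarrow>\<^sub>L real\<close> of bounded linear functionals with the
  operator norm. The Frechet derivative takes values in the dual, so that for a function
  on \<open>V\<^sup>*\<close> it takes values in the bidual.
\<close>

definition fgrad :: "('a::real_normed_vector \<Rightarrow> real) \<Rightarrow> 'a \<Rightarrow> ('a \<Rightarrow>\<^sub>L real)" where
  "fgrad F x = Blinfun (frechet_derivative F (at x))"

definition C1_functional :: "('a::real_normed_vector \<Rightarrow> real) \<Rightarrow> bool" where
  "C1_functional F \<longleftrightarrow> (\<forall>x. F differentiable (at x)) \<and> continuous_on UNIV (fgrad F)"

definition bregman :: "('a::real_normed_vector \<Rightarrow> real) \<Rightarrow> 'a \<Rightarrow> 'a \<Rightarrow> real" where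
  "bregman F x y = F x - F y - blinfun_apply (fgrad F y) (x - y)"

definition conjugate :: "('a::real_normed_vector \<Rightarrow> real) \<Rightarrow> ('a \<Rightarrow>\<^sub>L real) \<Rightarrow> ereal" where
  "conjugate \<Psi> \<phi> = (SUP x. ereal (blinfun_apply \<phi> x - \<Psi> x))"

text \<open>Only meaningful where the conjugate is finite.\<close>

definition conjugate_real :: "('a::real_normed_vector \<Rightarrow> real) \<Rightarrow> ('a \<Rightarrow>\<^sub>L real) \<Rightarrow> real" where
  "conjugate_real \<Psi> \<phi> = real_of_ereal (conjugate \<Psi> \<phi>)"

text \<open>
  The notions below are meant for functionals that never take the value \<open>-\<infinity>\<close>; for these
  no indeterminate sum or difference of extended reals occurs.
\<close>

definition convex_ereal :: "('a::real_vector \<Rightarrow> ereal) \<Rightarrow> bool" where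
  "convex_ereal F \<longleftrightarrow> (\<forall>x y. \<forall>u\<ge>0. \<forall>v\<ge>0. u + v = 1 \<longrightarrow>
     F (u *\<^sub>R x + v *\<^sub>R y) \<le> ereal u * F x + ereal v * F y)"

definition convex_relative ::
    "real \<Rightarrow> ('a::real_vector \<Rightarrow> real) \<Rightarrow> ('a \<Rightarrow> ereal) \<Rightarrow> bool" where
  "convex_relative lam \<Psi> \<Phi> \<longleftrightarrow> convex_ereal (\<lambda>x. \<Phi> x - ereal (lam * \<Psi> x))"

definition lower_semicontinuous :: "('a::topological_space \<Rightarrow> ereal) \<Rightarrow> bool" where
  "lower_semicontinuous F \<longleftrightarrow> (\<forall>x. F x \<le> Liminf (at x) F)"

definition frechet_subdifferential ::
    "('a::real_normed_vector \<Rightarrow> ereal) \<Rightarrow> 'a \<Rightarrow> ('a \<Rightarrow>\<^sub>L real) set" where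
  "frechet_subdifferential \<Phi> x = {\<xi>. \<Phi> x < \<infinity> \<and>
     Liminf (at x) (\<lambda>y. (\<Phi> y - \<Phi> x - ereal (blinfun_apply \<xi> (y - x))) / ereal (norm (y - x))) \<ge> 0}"

text \<open>
  A curve parametrised by \<open>[0,\<infinity>)\<close> is a function on \<open>real\<close>, whose values at negative times are
  irrelevant.
\<close>

definition locally_abs_continuous :: "(real \<Rightarrow> 'b::real_normed_vector) \<Rightarrow> bool" where
  "locally_abs_continuous u \<longleftrightarrow> (\<exists>A :: real \<Rightarrow> real.
     (\<forall>T\<ge>0. set_integrable lebesgue {0..T} A) \<and>
     (\<forall>s t. 0 \<le> s \<longrightarrow> s \<le> t \<longrightarrow> norm (u t - u s) \<le> set_lebesgue_integral lebesgue {s..t} A))"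

definition mirror_flow ::
    "('a::real_normed_vector \<Rightarrow> real) \<Rightarrow> ('a \<Rightarrow> ereal) \<Rightarrow> (real \<Rightarrow> 'a) \<Rightarrow> bool" where
  "mirror_flow \<Psi> \<Phi> x \<longleftrightarrow>
     locally_abs_continuous (\<lambda>t. fgrad \<Psi> (x t)) \<and>
     (AE t in lebesgue. t > 0 \<longrightarrow>
        (\<exists>p. ((\<lambda>s. fgrad \<Psi> (x s)) has_vector_derivative p) (at t) \<and>
             p \<in> uminus ` frechet_subdifferential \<Phi> (x t)))"

text \<open>Differentiability of an extended-real function of time: finite near \<open>t\<close>, with derivative \<open>d\<close>.\<close>

definition has_ereal_derivative :: "(real \<Rightarrow> ereal) \<Rightarrow> real \<Rightarrow> real \<Rightarrow> bool" where
  "has_ereal_derivative f d t \<longleftrightarrow>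
     (\<forall>\<^sub>F s in nhds t. \<bar>f s\<bar> \<noteq> \<infinity>) \<and>
     ((\<lambda>s. real_of_ereal (f s)) has_real_derivative d) (at t)"

text \<open>
  Extension of \<open>g\<close> by \<open>g(0) = \<infinity>\<close>; in \<open>ereal\<close> the product \<open>\<infinity> * 0\<close> is \<open>0\<close>.
\<close>

definition extend_at_0 :: "(real \<Rightarrow> real) \<Rightarrow> real \<Rightarrow> ereal" where
  "extend_at_0 g r = (if r = 0 then \<infinity> else ereal (g r))"

text \<open>
  The Bochner integral of the library presupposes a second countable target space, which
  a dual space need not be. The following definition is the library's definition of
  \<^const>\<open>has_bochner_integral\<close> for arbitrary normed targets. The approximation in mean
  forces \<open>f\<close> to be almost everywhere a limit of simple functions.
\<close>

definition bochner_integral_is ::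
    "'w measure \<Rightarrow> ('w \<Rightarrow> 'b::real_normed_vector) \<Rightarrow> 'b \<Rightarrow> bool" where
  "bochner_integral_is M f I \<longleftrightarrow> f \<in> borel_measurable M \<and>
     (\<exists>s. (\<forall>i. Bochner_Integration.simple_bochner_integrable M (s i)) \<and>
          (\<lambda>i. \<integral>\<^sup>+w. ennreal (norm (f w - s i w)) \<partial>M) \<longlonglongrightarrow> 0 \<and>
          (\<lambda>i. Bochner_Integration.simple_bochner_integral M (s i)) \<longlonglongrightarrow> I)"

definition vector_measure :: "'w measure \<Rightarrow> ('w set \<Rightarrow> 'b::real_normed_vector) \<Rightarrow> bool" where
  "vector_measure M G \<longleftrightarrow> (\<forall>E :: nat \<Rightarrow> 'w set. range E \<subseteq> sets M \<longrightarrow> disjoint_family E \<longrightarrow>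
     (\<lambda>i. G (E i)) sums G (\<Union>i. E i))"

definition bounded_total_variation ::
    "'w measure \<Rightarrow> ('w set \<Rightarrow> 'b::real_normed_vector) \<Rightarrow> bool" where
  "bounded_total_variation M G \<longleftrightarrow> (\<exists>B. \<forall>P. finite P \<longrightarrow> P \<subseteq> sets M \<longrightarrow> disjoint P \<longrightarrow>
     (\<Sum>E\<in>P. norm (G E)) \<le> B)"

text \<open>
  The Radon--Nikodym property of a Banach space: every vector measure of bounded variation that
  is absolutely continuous with respect to a finite measure has a Bochner integrable density.
  A definition cannot quantify over the type of the underlying measurable space; it is taken to be
  an arbitrary sigma-algebra on an arbitrary subset of \<open>real\<close>. This is no restriction, because
  Lebesgue measure on \<open>[0,1]\<close> already suffices to test the property (Diestel and Uhl, Vector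
  Measures, Chapter V.3).
\<close>

definition radon_nikodym_property :: "'b::banach itself \<Rightarrow> bool" where
  "radon_nikodym_property _ \<longleftrightarrow>
     (\<forall>(M :: real measure) (G :: real set \<Rightarrow> 'b).
        finite_measure M \<longrightarrow> vector_measure M G \<longrightarrow> bounded_total_variation M G \<longrightarrow>
        (\<forall>E\<in>null_sets M. G E = 0) \<longrightarrow>
        (\<exists>f. \<forall>E\<in>sets M. bochner_integral_is M (\<lambda>w. indicator E w *\<^sub>R f w) (G E)))"

end

theory Submission
  imports Defs
begin

text \<open>
  Write \<open>p\<^sub>t = \<nabla>\<Psi>(x\<^sub>t)\<close>. The function \<open>t \<mapsto> D\<^sub>\<Psi>(y, x\<^sub>t)\<close> is absolutely continuous with derivative
  \<open>\<langle>p'\<^sub>t, x\<^sub>t - y\<rangle>\<close>, so that the subdifferential inclusion and \<open>\<lambda>\<close>-convexity give the evolution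
  variational inequality
  \<open>d/dt D\<^sub>\<Psi>(y, x\<^sub>t) + \<lambda> D\<^sub>\<Psi>(y, x\<^sub>t) \<le> \<Phi>(y) - \<Phi>(x\<^sub>t)\<close>. Together with lower semicontinuity it forces
  \<open>t \<mapsto> \<Phi>(x\<^sub>t)\<close> to be finite and nonincreasing on \<open>(0, \<infinity>)\<close>, hence differentiable almost everywhere
  by Lebesgue's theorem. At a point \<open>s\<close> of differentiability, integrating the inequality for
  \<open>y = x\<^sub>s\<close> over \<open>[s, s + h]\<close> bounds \<open>D\<^sub>\<Psi>(x\<^sub>s, x\<^sub>s\<^sub>+\<^sub>h)\<close> by \<open>- d/ds \<Phi>(x\<^sub>s) h\<^sup>2/2\<close> to leading order. By
  duality it equals \<open>D\<^sub>\<Psi>\<^sub>*(p\<^sub>s\<^sub>+\<^sub>h, p\<^sub>s)\<close>, which is at least \<open>g(\<parallel>p\<^sub>s\<^sub>+\<^sub>h\<parallel> + \<parallel>p\<^sub>s\<parallel>) \<parallel>p\<^sub>s\<^sub>+\<^sub>h - p\<^sub>s\<parallel>\<^sup>2\<close>; divide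
  by \<open>h\<^sup>2\<close> and let \<open>h \<rightarrow> 0\<close>.
\<close>

section \<open>Absolutely continuous functions\<close>

text \<open>The measure with density \<open>\<bar>A\<bar>\<close> on \<open>{a..b}\<close>, pushed
  forward to the Borel sets so that outer regularity by open sets applies to it. The bound uses
  half-open intervals because these are additive under subdivision.\<close>

lemma finite_borel_measure_of_integrable:
  fixes A :: "real \<Rightarrow> real"
  assumes A: "set_integrable lebesgue {a..b} A"
  obtains \<nu> :: "real measure" where "finite_measure \<nu>" "sets \<nu> = sets borel"
    "\<And>N. N \<in> null_sets lborel \<Longrightarrow> emeasure \<nu> N = 0"
    "\<And>s t. a \<le> s \<Longrightarrow> s \<le> t \<Longrightarrow> t \<le> b \<Longrightarrow> (LINT r:{s..t}|lebesgue. A r) \<le> measure \<nu> {s<..t}"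
proof -
  define B where "B r = indicator {a..b} r * \<bar>A r\<bar>" for r
  have intB: "integrable lebesgue B"
    using integrable_abs[OF A[unfolded set_integrable_def]]
    by (simp add: B_def[abs_def] abs_mult)
  have B0: "B r \<ge> 0" for r by (simp add: B_def)
  have [measurable]: "B \<in> borel_measurable lebesgue" using intB by auto
  define \<nu> where "\<nu> = distr (density lebesgue (\<lambda>r. ennreal (B r))) borel (\<lambda>r. r)"
  have meas: "(\<lambda>r. r) \<in> density lebesgue (\<lambda>r. ennreal (B r)) \<rightarrow>\<^sub>M borel"
    by (simp add: measurable_completion)
  have em: "emeasure \<nu> X = ennreal (LINT r|lebesgue. B r * indicator X r)" if X: "X \<in> sets borel" for X
  proof -
    have XL[measurable]: "X \<in> sets lebesgue" using X by auto
    have "emeasure \<nu> X = emeasure (density lebesgue (\<lambda>r. ennreal (B r))) X"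
      unfolding \<nu>_def using X by (subst emeasure_distr[OF meas]) auto
    also have "\<dots> = (\<integral>\<^sup>+ r. ennreal (B r) * indicator X r \<partial>lebesgue)"
      by (rule emeasure_density) auto
    also have "\<dots> = (\<integral>\<^sup>+ r. ennreal (B r * indicator X r) \<partial>lebesgue)"
      by (intro nn_integral_cong) (auto simp: indicator_def)
    also have "\<dots> = ennreal (LINT r|lebesgue. B r * indicator X r)"
      using integrable_real_mult_indicator[OF XL intB] B0
      by (intro nn_integral_eq_integral) (auto simp: indicator_def)
    finally show ?thesis .
  qed
  show thesis
  proof
    show "finite_measure \<nu>"
      by (rule finite_measureI) (simp add: em \<nu>_def[THEN arg_cong[where f=space]])
    show sets: "sets \<nu> = sets borel" by (simp add: \<nu>_def)
    show "emeasure \<nu> N = 0" if "N \<in> null_sets lborel" for N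
    proof -
      have N: "N \<in> null_sets lebesgue" "N \<in> sets borel"
        using that by (auto intro: null_sets_completionI)
      have "(LINT r|lebesgue. B r * indicator N r) = (LINT r|lebesgue. 0)"
      proof (subst integral_cong_AE[where g="\<lambda>_. 0"])
        show "(\<lambda>r. B r * indicator N r) \<in> borel_measurable lebesgue" using N(1) by (intro borel_measurable_times borel_measurable_indicator) auto
        show "AE r in lebesgue. B r * indicator N r = 0"
          using AE_not_in[OF N(1)] by eventually_elim simp
      qed simp_all
      then show ?thesis by (simp add: em[OF N(2)])
    qed
    show "(LINT r:{s..t}|lebesgue. A r) \<le> measure \<nu> {s<..t}" if st: "a \<le> s" "s \<le> t" "t \<le> b" for s t
    proof -
      have "(LINT r:{s..t}|lebesgue. A r) \<le> (LINT r|lebesgue. B r * indicator {s<..t} r)"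
        unfolding set_lebesgue_integral_def
      proof (rule integral_mono_AE)
        show "integrable lebesgue (\<lambda>r. indicator {s..t} r *\<^sub>R A r)"
          using set_integrable_subset[OF A, of "{s..t}"] st unfolding set_integrable_def by auto
        show "integrable lebesgue (\<lambda>r. B r * indicator {s<..t} r)"
          by (rule integrable_real_mult_indicator) (auto intro: intB)
        have "AE r in lebesgue. r \<notin> {s}"
          by (intro AE_not_in null_sets_completionI) auto
        then show "AE r in lebesgue. indicator {s..t} r *\<^sub>R A r \<le> B r * indicator {s<..t} r"
          by (rule eventually_mono) (use st in \<open>auto simp: B_def indicator_def\<close>)
      qed
      also have "\<dots> = measure \<nu> {s<..t}"
        by (simp add: measure_def em integral_nonneg_AE B0)
      finally show ?thesis .
    qed
  qed
qed

text \<open>Covering the exceptional null set by an open set on which the dominating function has small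
  integral reduces the claim to a local inequality around every point.\<close>

lemma nonincreasing_if_AE_deriv_nonpos:
  fixes u A :: "real \<Rightarrow> real"
  assumes ab: "a \<le> b"
    and A: "set_integrable lebesgue {a..b} A"
    and dom: "\<And>s t. a \<le> s \<Longrightarrow> s \<le> t \<Longrightarrow> t \<le> b \<Longrightarrow> \<bar>u t - u s\<bar> \<le> (LINT r:{s..t}|lebesgue. A r)"
    and deriv: "AE t in lebesgue. a < t \<longrightarrow> t < b \<longrightarrow> (\<exists>d\<le>0. (u has_real_derivative d) (at t))"
  shows "u b \<le> u a"
proof -
  obtain \<nu> :: "real measure" where \<nu>: "finite_measure \<nu>" and sets: "sets \<nu> = sets borel"
    and null: "\<And>N. N \<in> null_sets lborel \<Longrightarrow> emeasure \<nu> N = 0"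
    and bound: "\<And>s t. a \<le> s \<Longrightarrow> s \<le> t \<Longrightarrow> t \<le> b \<Longrightarrow> (LINT r:{s..t}|lebesgue. A r) \<le> measure \<nu> {s<..t}"
    using finite_borel_measure_of_integrable[OF A] by blast
  interpret \<nu>: finite_measure \<nu> by fact
  obtain N0 where N0: "N0 \<in> null_sets lebesgue"
    "{t. \<not> (a < t \<longrightarrow> t < b \<longrightarrow> (\<exists>d\<le>0. (u has_real_derivative d) (at t)))} \<subseteq> N0"
    using deriv unfolding eventually_ae_filter by auto
  \<comment> \<open>No derivative is assumed at the end points, so they are treated as exceptional.
    The Borel null set \<open>N\<close> makes outer regularity applicable.\<close>
  have "insert a (insert b N0) \<in> null_sets lebesgue"
    using N0(1) by (simp add: null_sets_completionI null_sets.insert_in_sets negligible_iff_null_sets[symmetric])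
  then obtain N where N: "N \<in> null_sets lborel" "insert a (insert b N0) \<subseteq> N"
    unfolding null_sets_completion_iff2 by blast
  have "u b \<le> u a + \<epsilon> * (b - a) + \<epsilon>" if \<epsilon>: "\<epsilon> > 0" for \<epsilon>
  proof -
    have "emeasure \<nu> N = (INF U \<in> {U. N \<subseteq> U \<and> open U}. emeasure \<nu> U)"
      by (rule outer_regular) (use N sets in auto)
    then have "(INF U \<in> {U. N \<subseteq> U \<and> open U}. emeasure \<nu> U) < ennreal \<epsilon>"
      using null[OF N(1)] \<epsilon> by simp
    then obtain U where U: "N \<subseteq> U" "open U" "emeasure \<nu> U < ennreal \<epsilon>"
      unfolding INF_less_iff by blast
    have Usets: "U \<in> sets \<nu>" using U(2) sets by simp
    define V where "V t = measure \<nu> (U \<inter> {..t})" for t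
    have Vdiff: "V t - V s = measure \<nu> (U \<inter> {s<..t})" if "s \<le> t" for s t
    proof -
      have "V t = measure \<nu> (U \<inter> {..s} \<union> U \<inter> {s<..t})"
        unfolding V_def using that by (intro arg_cong[where f="measure \<nu>"]) auto
      also have "\<dots> = V s + measure \<nu> (U \<inter> {s<..t})"
        unfolding V_def by (rule \<nu>.finite_measure_Union) (use Usets sets in auto)
      finally show ?thesis by simp
    qed
    \<comment> \<open>The term \<open>\<epsilon> * t\<close> pays for the first-order error at
      points with a derivative, and \<open>V\<close> pays for the growth of \<open>u\<close> at
      exceptional points. Over the whole interval they cost at most
      \<open>\<epsilon> * (b - a)\<close> and \<open>\<epsilon>\<close>.\<close>
    define h where "h t = u t - \<epsilon> * t - V t" for t
    \<comment> \<open>The local condition of \<open>Bolzano\<close> concerns all short intervals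
      around a point, including those that leave \<open>{a..b}\<close>; hence the guards.\<close>
    define P where "P c e \<longleftrightarrow> (a \<le> c \<longrightarrow> c \<le> e \<longrightarrow> e \<le> b \<longrightarrow> h e \<le> h c)" for c e
    have "P a b"
      using ab
    proof (induction rule: Bolzano)
      case (trans c d e)
      then show ?case by (auto simp: P_def)
    next
      case (local t)
      show ?case
      proof (cases "t \<in> N")
        case True
        then obtain \<delta> where \<delta>: "\<delta> > 0" "ball t \<delta> \<subseteq> U"
          using U openE by blast
        have "P c e" if ce: "c \<le> t" "t \<le> e" "e - c < \<delta>" for c e
          unfolding P_def
        proof (intro impI)
          assume *: "a \<le> c" "c \<le> e" "e \<le> b"
          have "{c<..e} \<subseteq> U"
            using ce by (intro order_trans[OF _ \<delta>(2)]) (auto simp: dist_real_def)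
          then have "V e - V c = measure \<nu> {c<..e}"
            using Vdiff[OF *(2)] by (simp add: Int_absorb1)
          then have "u e - u c \<le> V e - V c"
            using dom[OF *] bound[OF *] by linarith
          moreover have "\<epsilon> * c \<le> \<epsilon> * e" using \<epsilon> *(2) by simp
          ultimately show "h e \<le> h c" unfolding h_def by linarith
        qed
        then show ?thesis using \<delta>(1) by blast
      next
        case False
        then have "a < t" "t < b" using local N(2) by (auto simp: order.strict_iff_order)
        then obtain d where d: "d \<le> 0" "(u has_real_derivative d) (at t)"
          using False N(2) N0(2) by blast
        from d(2)[unfolded has_field_derivative_def has_derivative_within_alt, simplified] \<epsilon>
        obtain \<delta> where \<delta>: "\<delta> > 0"
          "\<And>y. \<bar>y - t\<bar> < \<delta> \<Longrightarrow> \<bar>u y - u t - d * (y - t)\<bar> \<le> \<epsilon> * \<bar>y - t\<bar>"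
          by (auto simp: mult.commute)
        have "P c e" if ce: "c \<le> t" "t \<le> e" "e - c < \<delta>" for c e
          unfolding P_def
        proof (intro impI)
          assume *: "a \<le> c" "c \<le> e" "e \<le> b"
          have "u e - u t - d * (e - t) \<le> \<epsilon> * (e - t)" "u t - u c + d * (c - t) \<le> \<epsilon> * (t - c)"
            using \<delta>(2)[of e] \<delta>(2)[of c] ce by (auto simp: abs_le_iff algebra_simps)
          moreover have "d * (e - c) \<le> 0" using d(1) *(2) by (simp add: mult_nonpos_nonneg)
          moreover have "V c \<le> V e" using Vdiff[OF *(2)] measure_nonneg[of \<nu> "U \<inter> {c<..e}"] by linarith
          ultimately show "h e \<le> h c" by (simp add: h_def algebra_simps)
        qed
        then show ?thesis using \<delta>(1) by blast
      qed
    qed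
    then have "h b \<le> h a" using ab by (simp add: P_def)
    moreover have "V b - V a \<le> \<epsilon>"
    proof -
      have "V b - V a \<le> measure \<nu> U"
        unfolding Vdiff[OF ab] by (rule \<nu>.finite_measure_mono) (use Usets in auto)
      also have "\<dots> \<le> \<epsilon>"
        using U(3) \<epsilon> by (simp add: measure_def enn2real_leI less_imp_le)
      finally show ?thesis .
    qed
    ultimately show ?thesis by (simp add: h_def algebra_simps)
  qed
  then have *: "u b \<le> u a + \<epsilon> * (b - a + 1)" if "\<epsilon> > 0" for \<epsilon>
    using that by (simp add: algebra_simps)
  have "u b \<le> u a + \<epsilon>" if "\<epsilon> > 0" for \<epsilon>
    using *[of "\<epsilon> / (b - a + 1)"] that ab by simp
  then show ?thesis by (rule field_le_epsilon)
qed

section \<open>Calculus of absolutely continuous curves on compact intervals\<close>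

text \<open>Same domination as in \<open>locally_abs_continuous\<close>, but on one compact
  interval, where continuous factors are bounded and which may start at a positive time.\<close>

definition abs_cont_on :: "real \<Rightarrow> real \<Rightarrow> (real \<Rightarrow> 'b::real_normed_vector) \<Rightarrow> bool" where
  "abs_cont_on a b u \<longleftrightarrow> (\<exists>A :: real \<Rightarrow> real. set_integrable lebesgue {a..b} A \<and>
     (\<forall>s t. a \<le> s \<longrightarrow> s \<le> t \<longrightarrow> t \<le> b \<longrightarrow> norm (u t - u s) \<le> (LINT r:{s..t}|lebesgue. A r)))"

text \<open>The integrand \<open>K * A + L * B\<close> dominates \<open>w\<close>. Differences,
  products, C1 functions and the divergence along the flow are all reduced to this
  criterion.\<close>

lemma abs_cont_on_dominated:
  assumes u: "abs_cont_on a b u" and v: "abs_cont_on a b v" and K: "K \<ge> 0" and L: "L \<ge> 0"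
    and dom: "\<And>s t. a \<le> s \<Longrightarrow> s \<le> t \<Longrightarrow> t \<le> b \<Longrightarrow>
      norm (w t - w s) \<le> K * norm (u t - u s) + L * norm (v t - v s)"
  shows "abs_cont_on a b w"
proof -
  obtain A where A: "set_integrable lebesgue {a..b} A"
    "\<And>s t. a \<le> s \<Longrightarrow> s \<le> t \<Longrightarrow> t \<le> b \<Longrightarrow> norm (u t - u s) \<le> (LINT r:{s..t}|lebesgue. A r)"
    using u unfolding abs_cont_on_def by blast
  obtain B where B: "set_integrable lebesgue {a..b} B"
    "\<And>s t. a \<le> s \<Longrightarrow> s \<le> t \<Longrightarrow> t \<le> b \<Longrightarrow> norm (v t - v s) \<le> (LINT r:{s..t}|lebesgue. B r)"
    using v unfolding abs_cont_on_def by blast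
  have "norm (w t - w s) \<le> (LINT r:{s..t}|lebesgue. K * A r + L * B r)" if st: "a \<le> s" "s \<le> t" "t \<le> b" for s t
  proof -
    have "set_integrable lebesgue {s..t} A" "set_integrable lebesgue {s..t} B"
      using st by (auto intro: set_integrable_subset[OF A(1)] set_integrable_subset[OF B(1)])
    then have "(LINT r:{s..t}|lebesgue. K * A r + L * B r) =
        K * (LINT r:{s..t}|lebesgue. A r) + L * (LINT r:{s..t}|lebesgue. B r)"
      by simp
    moreover have "K * norm (u t - u s) + L * norm (v t - v s) \<le>
        K * (LINT r:{s..t}|lebesgue. A r) + L * (LINT r:{s..t}|lebesgue. B r)"
      using A(2)[OF st] B(2)[OF st] K L by (intro add_mono mult_left_mono)
    ultimately show ?thesis using dom[OF st] by linarith
  qed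
  moreover have "set_integrable lebesgue {a..b} (\<lambda>r. K * A r + L * B r)"
    using A(1) B(1) by (intro set_integral_add(1) set_integrable_mult_right) auto
  ultimately show ?thesis unfolding abs_cont_on_def by blast
qed

lemma abs_cont_on_id: "abs_cont_on a b (\<lambda>t::real. t)"
  unfolding abs_cont_on_def
proof (intro exI[of _ "\<lambda>_. 1"] conjI allI impI)
  show "set_integrable lebesgue {a..b} (\<lambda>_. 1::real)"
    using integrable_on_const[of "{a..b}"] by (intro absolutely_integrable_on_const) auto
  show "norm (t - s) \<le> (LINT r:{s..t}|lebesgue. 1)" if "s \<le> t" for s t :: real
    using that by (simp add: set_lebesgue_integral_def)
qed

lemma abs_cont_on_diff:
  assumes u: "abs_cont_on a b u" and v: "abs_cont_on a b v"
  shows "abs_cont_on a b (\<lambda>t. u t - v t)"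
proof (rule abs_cont_on_dominated[OF u v zero_le_one zero_le_one])
  show "norm (u t - v t - (u s - v s)) \<le> 1 * norm (u t - u s) + 1 * norm (v t - v s)" for s t
    using norm_triangle_ineq4[of "u t - u s" "v t - v s"] by (simp add: diff_diff_eq add_diff_eq diff_diff_eq2 add.commute)
qed

text \<open>Increments of \<open>u\<close> are bounded by those of the indefinite integral of
  \<open>A\<close>, which is continuous.\<close>

lemma continuous_on_abs_cont_on:
  assumes "abs_cont_on a b u"
  shows "continuous_on {a..b} u"
proof -
  obtain A where A: "set_integrable lebesgue {a..b} A"
    "\<And>s t. a \<le> s \<Longrightarrow> s \<le> t \<Longrightarrow> t \<le> b \<Longrightarrow> norm (u t - u s) \<le> (LINT r:{s..t}|lebesgue. A r)"
    using assms unfolding abs_cont_on_def by blast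
  define V where "V t = integral {a..t} A" for t
  have int: "A integrable_on {a..b}"
    by (rule set_lebesgue_integral_eq_integral(1)[OF A(1)])
  have V: "continuous_on {a..b} V"
    unfolding V_def[abs_def] by (rule indefinite_integral_continuous_1[OF int])
  have le: "norm (u t - u s) \<le> V t - V s" if st: "a \<le> s" "s \<le> t" "t \<le> b" for s t
  proof -
    have "(LINT r:{s..t}|lebesgue. A r) = integral {s..t} A"
      using st by (intro set_lebesgue_integral_eq_integral set_integrable_subset[OF A(1)]) auto
    moreover have "integral {a..s} A + integral {s..t} A = integral {a..t} A"
      using st by (intro Henstock_Kurzweil_Integration.integral_combine integrable_on_subinterval[OF int]) auto
    ultimately show ?thesis using A(2)[OF st] by (simp add: V_def)
  qed
  then have dist: "dist (u t) (u s) \<le> dist (V t) (V s)" if "s \<in> {a..b}" "t \<in> {a..b}" for s t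
  proof (cases "s \<le> t")
    case True
    then show ?thesis using le[of s t] that by (simp add: dist_norm)
  next
    case False
    then show ?thesis using le[of t s] that by (simp add: dist_norm norm_minus_commute)
  qed
  show ?thesis
    unfolding continuous_on_iff
  proof (intro ballI allI impI)
    fix s and e :: real assume s: "s \<in> {a..b}" and "0 < e"
    then obtain d where "d > 0" "\<And>t. t \<in> {a..b} \<Longrightarrow> dist t s < d \<Longrightarrow> dist (V t) (V s) < e"
      using V unfolding continuous_on_iff by meson
    then show "\<exists>d>0. \<forall>t\<in>{a..b}. dist t s < d \<longrightarrow> dist (u t) (u s) < e"
      using dist[OF s] by (meson le_less_trans)
  qed
qed

lemma bounded_on_compact_interval:
  assumes "continuous_on {a..b::real} (u :: real \<Rightarrow> 'b::real_normed_vector)"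
  obtains K where "K \<ge> 0" "\<And>t. t \<in> {a..b} \<Longrightarrow> norm (u t) \<le> K"
proof -
  have "bounded (u ` {a..b})"
    using assms by (intro compact_imp_bounded compact_continuous_image) auto
  then obtain K where "\<forall>y\<in>u ` {a..b}. norm y \<le> K" unfolding bounded_iff by blast
  then show thesis by (intro that[of "max K 0"]) (auto simp: le_max_iff_disj)
qed

lemma abs_cont_on_mult:
  fixes u v :: "real \<Rightarrow> real"
  assumes u: "abs_cont_on a b u" and v: "abs_cont_on a b v"
  shows "abs_cont_on a b (\<lambda>t. u t * v t)"
proof -
  obtain K where K: "K \<ge> 0" "\<And>t. t \<in> {a..b} \<Longrightarrow> norm (u t) \<le> K"
    using bounded_on_compact_interval[OF continuous_on_abs_cont_on[OF u]] by blast
  obtain L where L: "L \<ge> 0" "\<And>t. t \<in> {a..b} \<Longrightarrow> norm (v t) \<le> L"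
    using bounded_on_compact_interval[OF continuous_on_abs_cont_on[OF v]] by blast
  show ?thesis
  proof (rule abs_cont_on_dominated[OF u v L(1) K(1)])
    fix s t assume st: "a \<le> s" "s \<le> t" "t \<le> b"
    have "u t * v t - u s * v s = (u t - u s) * v s + u t * (v t - v s)"
      by (simp add: algebra_simps)
    also have "norm \<dots> \<le> norm (u t - u s) * norm (v s) + norm (u t) * norm (v t - v s)"
      by (rule order_trans[OF norm_triangle_ineq]) (simp add: abs_mult)
    also have "\<dots> \<le> norm (u t - u s) * L + K * norm (v t - v s)"
      using K(2)[of t] L(2)[of s] st by (intro add_mono mult_mono) auto
    finally show "norm (u t * v t - u s * v s) \<le> L * norm (u t - u s) + K * norm (v t - v s)"
      by (simp add: mult.commute)
  qed
qed

lemma abs_cont_on_C1: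
  fixes u :: "real \<Rightarrow> real"
  assumes "\<And>t. (u has_real_derivative u' t) (at t)" and "continuous_on {a..b} u'"
  shows "abs_cont_on a b u"
proof -
  obtain K where K: "K \<ge> 0" "\<And>t. t \<in> {a..b} \<Longrightarrow> norm (u' t) \<le> K"
    using bounded_on_compact_interval[OF assms(2)] by blast
  have "norm (u t - u s) \<le> K * norm (t - s)" if "a \<le> s" "s \<le> t" "t \<le> b" for s t
  proof (rule field_differentiable_bound[of "{a..b}" u u'])
    show "(u has_field_derivative u' z) (at z within {a..b})" for z
      by (rule has_field_derivative_at_within[OF assms(1)])
  qed (use K that in auto)
  then show ?thesis
    using K(1) by (intro abs_cont_on_dominated[OF abs_cont_on_id abs_cont_on_id, where K=K and L=0]) auto
qed

lemma abs_cont_on_nonincreasing: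
  fixes u :: "real \<Rightarrow> real"
  assumes "abs_cont_on a b u" "a \<le> b"
    and "AE t in lebesgue. a < t \<longrightarrow> t < b \<longrightarrow> (\<exists>d\<le>0. (u has_real_derivative d) (at t))"
  shows "u b \<le> u a"
proof -
  obtain A where A: "set_integrable lebesgue {a..b} A"
    "\<And>s t. a \<le> s \<Longrightarrow> s \<le> t \<Longrightarrow> t \<le> b \<Longrightarrow> \<bar>u t - u s\<bar> \<le> (LINT r:{s..t}|lebesgue. A r)"
    using assms(1) unfolding abs_cont_on_def real_norm_def by blast
  show ?thesis
    by (rule nonincreasing_if_AE_deriv_nonpos[OF assms(2) A assms(3)])
qed

lemma abs_cont_on_if_locally_abs_continuous:
  assumes "locally_abs_continuous u" "0 \<le> a"
  shows "abs_cont_on a b u"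
proof -
  obtain A :: "real \<Rightarrow> real" where A: "\<And>T. T \<ge> 0 \<Longrightarrow> set_integrable lebesgue {0..T} A"
    "\<And>s t. 0 \<le> s \<Longrightarrow> s \<le> t \<Longrightarrow> norm (u t - u s) \<le> (LINT r:{s..t}|lebesgue. A r)"
    using assms(1) unfolding locally_abs_continuous_def by blast
  have "set_integrable lebesgue {a..b} A"
    using assms(2) by (intro set_integrable_subset[OF A(1)[of "max b 0"]]) auto
  then show ?thesis
    using A(2) assms(2) unfolding abs_cont_on_def by (intro exI[of _ A]) auto
qed

section \<open>Differentiability of monotone functions\<close>

lemma Vitali_covering_intervals:
  fixes S :: "real set"
  assumes "\<And>x d. x \<in> S \<Longrightarrow> 0 < d \<Longrightarrow> \<exists>u v. u < v \<and> u \<le> x \<and> x \<le> v \<and> v - u < d \<and> P u v"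
  obtains C where "countable C" "\<And>u v. (u, v) \<in> C \<Longrightarrow> u < v \<and> P u v"
    "disjoint_family_on (\<lambda>(u, v). {u..v}) C"
    "negligible (S - (\<Union>(u, v)\<in>C. {u..v}))"
proof -
  define K where "K = {(u, v). u < v \<and> P u v}"
  have cb: "cball ((fst c + snd c) / 2) ((snd c - fst c) / 2) = {fst c..snd c}" for c :: "real \<times> real"
    by (auto simp: cball_eq_atLeastAtMost field_simps)
  obtain C where C: "countable C" "C \<subseteq> K"
    "pairwise (\<lambda>i j. disjnt {fst i..snd i} {fst j..snd j}) C"
    "negligible (S - (\<Union>i\<in>C. {fst i..snd i}))"
  proof (rule Vitali_covering_theorem_cballs[where K=K and S=S
        and a="\<lambda>c. (fst c + snd c) / 2" and r="\<lambda>c. (snd c - fst c) / 2", unfolded cb])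
    show "0 < (snd c - fst c) / 2" if "c \<in> K" for c
      using that by (auto simp: K_def)
    show "\<exists>c. c \<in> K \<and> x \<in> {fst c..snd c} \<and> (snd c - fst c) / 2 < d" if "x \<in> S" "0 < d" for x d
      \<comment> \<open>The covering theorem for balls controls the radius, which is half the length
        of the interval.\<close>
      using assms[of x "2 * d"] that by (fastforce simp: K_def)
  qed
  show thesis
  proof
    show "countable C" by fact
    show "u < v \<and> P u v" if "(u, v) \<in> C" for u v
      using that C(2) by (auto simp: K_def)
    show "disjoint_family_on (\<lambda>(u, v). {u..v}) C"
      using C(3) by (auto simp: disjoint_family_on_def pairwise_def disjnt_def split_beta)
    show "negligible (S - (\<Union>(u, v)\<in>C. {u..v}))"
      using C(4) by (simp add: split_beta)
  qed
qed

text \<open>Sets of points with prescribed slopes are not shown to be measurable, so they are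
  handled by outer measure; a Vitali covering then bounds it up to a negligible remainder.\<close>

lemma outer_measure_of_le_if_negligible_diff:
  fixes S T :: "'a::euclidean_space set"
  assumes "negligible (S - T)" "T \<in> sets lebesgue"
  shows "outer_measure_of lebesgue S \<le> emeasure lebesgue T"
proof -
  have N: "S - T \<in> null_sets lebesgue" using assms(1) by (simp add: negligible_iff_null_sets)
  have "outer_measure_of lebesgue S \<le> outer_measure_of lebesgue (T \<union> (S - T))"
    by (rule outer_measure_of_mono) auto
  also have "\<dots> = emeasure lebesgue (T \<union> (S - T))"
    using N[THEN null_setsD2] assms(2) by (intro outer_measure_of_eq sets.Un)
  also have "\<dots> = emeasure lebesgue T"
    using N assms(2) by (intro emeasure_Un_null_set) auto
  finally show ?thesis .
qed

text \<open>For monotone \<open>F\<close>, disjoint closed intervals are mapped to disjoint open intervals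
  \<open>(F u, F v)\<close>, so that sums of increments are Lebesgue measures of unions.\<close>

lemma emeasure_UN_increments:
  fixes F :: "real \<Rightarrow> real"
  assumes "mono F" "countable C" and less: "\<And>u v. (u, v) \<in> C \<Longrightarrow> u < v"
    and disj: "disjoint_family_on (\<lambda>(u, v). {u..v}) C"
  shows "emeasure lebesgue (\<Union>(u, v)\<in>C. {F u<..<F v}) = (\<integral>\<^sup>+(u, v). ennreal (F v - F u) \<partial>count_space C)"
proof -
  have "disjoint_family_on (\<lambda>(u, v). {F u<..<F v}) C"
    unfolding disjoint_family_on_def
  proof (intro ballI impI)
    fix c e assume ce: "c \<in> C" "e \<in> C" "c \<noteq> e"
    obtain u v u' v' where [simp]: "c = (u, v)" "e = (u', v')" by fastforce
    have "{u..v} \<inter> {u'..v'} = {}"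
      using disj ce unfolding disjoint_family_on_def by fastforce
    then have "v < u' \<or> v' < u"
      using less[of u v] less[of u' v'] ce by (auto simp: Int_atLeastAtMost)
    then have "F v \<le> F u' \<or> F v' \<le> F u"
      using assms(1) by (auto simp: mono_def)
    then show "(case c of (u, v) \<Rightarrow> {F u<..<F v}) \<inter> (case e of (u, v) \<Rightarrow> {F u<..<F v}) = {}"
      by auto
  qed
  then have "emeasure lebesgue (\<Union>(u, v)\<in>C. {F u<..<F v}) =
    (\<integral>\<^sup>+c. emeasure lebesgue (case c of (u, v) \<Rightarrow> {F u<..<F v}) \<partial>count_space C)"
    by (intro emeasure_UN_countable assms(2)) auto
  also have "\<dots> = (\<integral>\<^sup>+(u, v). ennreal (F v - F u) \<partial>count_space C)"
  proof (rule nn_integral_cong)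
    fix c assume "c \<in> space (count_space C)"
    then obtain u v where "c = (u, v)" "u < v" using less by (cases c) auto
    moreover then have "F u \<le> F v" using assms(1) by (simp add: mono_def)
    ultimately show "emeasure lebesgue (case c of (u, v) \<Rightarrow> {F u<..<F v}) = (case c of (u, v) \<Rightarrow> ennreal (F v - F u))"
      by simp
  qed
  finally show ?thesis .
qed

lemma emeasure_UN_intervals:
  assumes "countable C" and less: "\<And>u v. (u, v) \<in> C \<Longrightarrow> u < v"
    and disj: "disjoint_family_on (\<lambda>(u, v). {u..v::real}) C"
  shows "emeasure lebesgue (\<Union>(u, v)\<in>C. {u..v}) = (\<integral>\<^sup>+(u, v). ennreal (v - u) \<partial>count_space C)"
proof -
  have "emeasure lebesgue (\<Union>(u, v)\<in>C. {u..v}) =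
    (\<integral>\<^sup>+c. emeasure lebesgue (case c of (u, v) \<Rightarrow> {u..v}) \<partial>count_space C)"
    using disj by (intro emeasure_UN_countable assms(1)) auto
  also have "\<dots> = (\<integral>\<^sup>+(u, v). ennreal (v - u) \<partial>count_space C)"
    using less by (intro nn_integral_cong) (auto dest!: less intro: less_imp_le)
  finally show ?thesis .
qed

text \<open>Disjoint steep intervals cover almost all of \<open>S\<close>. Their images are disjoint
  parts of \<open>G\<close>, with total measure at least \<open>q\<close> times the total length of
  the intervals.\<close>

lemma emeasure_increments_ge:
  fixes F :: "real \<Rightarrow> real"
  assumes F: "mono F" and q: "q > 0" and G: "G \<in> sets lebesgue"
    and steep: "\<And>x d. x \<in> S \<Longrightarrow> 0 < d \<Longrightarrow> \<exists>u v. u < v \<and> u \<le> x \<and> x \<le> v \<and> v - u < d \<and>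
      q * (v - u) \<le> F v - F u \<and> {F u<..<F v} \<subseteq> G"
  shows "ennreal q * outer_measure_of lebesgue S \<le> emeasure lebesgue G"
proof -
  obtain C where C: "countable C"
    "\<And>u v. (u, v) \<in> C \<Longrightarrow> u < v \<and> q * (v - u) \<le> F v - F u \<and> {F u<..<F v} \<subseteq> G"
    "disjoint_family_on (\<lambda>(u, v). {u..v}) C"
    "negligible (S - (\<Union>(u, v)\<in>C. {u..v}))"
    using Vitali_covering_intervals[OF steep, where S=S] by blast
  have "ennreal q * outer_measure_of lebesgue S \<le> ennreal q * emeasure lebesgue (\<Union>(u, v)\<in>C. {u..v})"
    using C(1) by (intro mult_left_mono outer_measure_of_le_if_negligible_diff C(4) sets.countable_UN') auto
  also have "\<dots> = ennreal q * (\<integral>\<^sup>+(u, v). ennreal (v - u) \<partial>count_space C)"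
    using C(2) by (subst emeasure_UN_intervals[OF C(1) _ C(3)]) auto
  also have "\<dots> = (\<integral>\<^sup>+c. ennreal q * (case c of (u, v) \<Rightarrow> ennreal (v - u)) \<partial>count_space C)"
    by (simp add: nn_integral_cmult)
  also have "\<dots> \<le> (\<integral>\<^sup>+(u, v). ennreal (F v - F u) \<partial>count_space C)"
    using C(2) q by (intro nn_integral_mono) (auto simp: ennreal_mult'[symmetric] intro!: ennreal_leI)
  also have "\<dots> = emeasure lebesgue (\<Union>(u, v)\<in>C. {F u<..<F v})"
    using C(2) by (intro emeasure_UN_increments[OF F C(1) _ C(3), symmetric]) auto
  also have "\<dots> \<le> emeasure lebesgue G"
    using C(2) G by (intro emeasure_mono) auto
  finally show ?thesis .
qed

lemma finite_outer_measure_of_bounded: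
  fixes S :: "real set"
  assumes "S \<subseteq> {a..b}"
  shows "outer_measure_of lebesgue S < \<infinity>"
  using outer_measure_of_mono[OF assms, of lebesgue] emeasure_lborel_cbox_finite[of a b]
  by (simp add: order_le_less_trans)

lemma negligible_if_outer_measure_of_zero:
  assumes "outer_measure_of lebesgue S = 0"
  shows "negligible (S :: 'a::euclidean_space set)"
proof -
  obtain E where "E \<in> sets lebesgue" "S \<subseteq> E" "emeasure lebesgue E = 0"
    using outer_measure_of_attain[of S lebesgue] assms by auto
  then show ?thesis
    using negligible_subset[of E S] by (simp add: negligible_iff_null_sets null_setsI)
qed

text \<open>Slopes are taken over all short intervals containing the point, not over one-sided ones as for
  Dini derivates. The hypotheses are then symmetric and one covering argument suffices.\<close>

lemma negligible_oscillating_slopes: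
  fixes F :: "real \<Rightarrow> real"
  assumes F: "mono F" and pq: "p < q" and bdd: "S \<subseteq> {a..b}"
    and flat: "\<And>x d. x \<in> S \<Longrightarrow> 0 < d \<Longrightarrow>
      \<exists>u v. u < v \<and> u \<le> x \<and> x \<le> v \<and> v - u < d \<and> F v - F u \<le> p * (v - u)"
    and steep: "\<And>x d. x \<in> S \<Longrightarrow> 0 < d \<Longrightarrow>
      \<exists>u v. u < v \<and> u \<le> x \<and> x \<le> v \<and> v - u < d \<and> q * (v - u) \<le> F v - F u"
  shows "negligible S"
proof (cases "S = {}")
  case False
  then obtain x where "x \<in> S" by blast
  from flat[OF this zero_less_one] obtain u v where "u < v" "F v - F u \<le> p * (v - u)" by blast
  moreover from this have "F u \<le> F v" using F by (simp add: mono_def)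
  \<comment> \<open>A monotone function has no negative slope, so a single flat interval already
    gives this.\<close>
  ultimately have p: "p \<ge> 0" by (metis diff_ge_0_iff_ge diff_gt_0_iff_gt order_trans zero_le_mult_iff not_le)
  define m where "m = outer_measure_of lebesgue S"
  have m: "m < \<infinity>" unfolding m_def by (rule finite_outer_measure_of_bounded[OF bdd])
  obtain B where B: "B \<in> sets lebesgue" "S \<subseteq> B" "m = emeasure lebesgue B"
    using outer_measure_of_attain[of S lebesgue] by (auto simp: m_def)
  \<comment> \<open>Two nested coverings: disjoint flat intervals inside an open \<open>U\<close>
    only slightly larger than \<open>S\<close>, then steep intervals inside these. The increments
    over the steep ones add up to at least \<open>q * m\<close>, those over the flat ones to at most
    \<open>p * (m + \<epsilon>)\<close>, and the former images lie in the latter.\<close>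
  have le: "ennreal q * m \<le> ennreal p * (m + ennreal \<epsilon>)" if \<epsilon>: "\<epsilon> > 0" for \<epsilon>
  proof -
    obtain U where U: "open U" "B \<subseteq> U" "emeasure lebesgue (U - B) < ennreal \<epsilon>"
      using sets_lebesgue_outer_open[OF B(1) \<epsilon>] by blast
    have Um: "emeasure lebesgue U \<le> m + ennreal \<epsilon>"
    proof -
      have "emeasure lebesgue U \<le> emeasure lebesgue (B \<union> (U - B))"
        using U B by (intro emeasure_mono) auto
      also have "\<dots> \<le> m + emeasure lebesgue (U - B)"
        unfolding B(3) using B U by (intro emeasure_subadditive) auto
      also have "\<dots> \<le> m + ennreal \<epsilon>" using U(3) by (intro add_left_mono) simp
      finally show ?thesis .
    qed
    have "\<exists>u v. u < v \<and> u \<le> x \<and> x \<le> v \<and> v - u < d \<and> (F v - F u \<le> p * (v - u) \<and> {u..v} \<subseteq> U)"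
      if x: "x \<in> S" and d: "0 < d" for x d
    proof -
      obtain e where e: "e > 0" "ball x e \<subseteq> U" using U(1,2) B(2) x openE by blast
      obtain u v where uv: "u < v" "u \<le> x" "x \<le> v" "v - u < min d e" "F v - F u \<le> p * (v - u)"
        using flat[OF x, of "min d e"] d e(1) by auto
      have "{u..v} \<subseteq> ball x e" using uv by (auto simp: dist_real_def)
      then show ?thesis using uv e(2) by (intro exI[of _ u] exI[of _ v]) auto
    qed
    then obtain C where C: "countable C"
      "\<And>u v. (u, v) \<in> C \<Longrightarrow> u < v \<and> (F v - F u \<le> p * (v - u) \<and> {u..v} \<subseteq> U)"
      "disjoint_family_on (\<lambda>(u, v). {u..v}) C"
      "negligible (S - (\<Union>(u, v)\<in>C. {u..v}))"
      using Vitali_covering_intervals[of S "\<lambda>u v. F v - F u \<le> p * (v - u) \<and> {u..v} \<subseteq> U"]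
      by (metis (no_types, lifting))
    \<comment> \<open>Only around interior points do all short intervals stay inside the flat
      interval. The end points lost are countably many.\<close>
    define S' where "S' = S \<inter> (\<Union>(u, v)\<in>C. {u<..<v})"
    define G where "G = (\<Union>(u, v)\<in>C. {F u<..<F v})"
    have Gs: "G \<in> sets lebesgue"
      unfolding G_def using C(1) by (intro sets.countable_UN') auto
    have "m \<le> outer_measure_of lebesgue S'"
    proof -
      obtain E where E: "E \<in> sets lebesgue" "S' \<subseteq> E" "outer_measure_of lebesgue S' = emeasure lebesgue E"
        using outer_measure_of_attain[of S' lebesgue] by auto
      have "negligible (fst ` C \<union> snd ` C)"
        using C(1) unfolding negligible_iff_null_sets
        by (intro null_sets_completionI countable_imp_null_set_lborel) auto
      moreover have "S - E \<subseteq> (S - (\<Union>(u, v)\<in>C. {u..v})) \<union> (fst ` C \<union> snd ` C)"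
        using E(2) by (fastforce simp: S'_def image_iff)
      ultimately have "negligible (S - E)"
        using C(4) by (meson negligible_Un negligible_subset)
      then show ?thesis
        unfolding m_def E(3) by (rule outer_measure_of_le_if_negligible_diff[OF _ E(1)])
    qed
    then have "ennreal q * m \<le> ennreal q * outer_measure_of lebesgue S'"
      by (rule mult_left_mono) simp
    also have "\<dots> \<le> emeasure lebesgue G"
    proof (rule emeasure_increments_ge[OF F _ Gs])
      show "q > 0" using p pq by simp
      fix x d :: real assume x: "x \<in> S'" and d: "0 < d"
      then obtain a' b' where ab: "(a', b') \<in> C" "a' < x" "x < b'" "x \<in> S"
        by (auto simp: S'_def)
      obtain u v where uv: "u < v" "u \<le> x" "x \<le> v" "v - u < min d (min (x - a') (b' - x))"
        "q * (v - u) \<le> F v - F u"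
        using steep[OF ab(4), of "min d (min (x - a') (b' - x))"] d ab by auto
      then have "a' \<le> u" "v \<le> b'" by auto
      then have "F a' \<le> F u" "F v \<le> F b'" using F by (auto simp: mono_def)
      then have "{F u<..<F v} \<subseteq> {F a'<..<F b'}" by auto
      then have "{F u<..<F v} \<subseteq> G" using ab(1) by (auto simp: G_def)
      then show "\<exists>u v. u < v \<and> u \<le> x \<and> x \<le> v \<and> v - u < d \<and> q * (v - u) \<le> F v - F u \<and> {F u<..<F v} \<subseteq> G"
        using uv by (intro exI[of _ u] exI[of _ v]) auto
    qed
    also have "emeasure lebesgue G = (\<integral>\<^sup>+(u, v). ennreal (F v - F u) \<partial>count_space C)"
      unfolding G_def using C(2) by (intro emeasure_UN_increments[OF F C(1) _ C(3)]) auto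
    also have "\<dots> \<le> (\<integral>\<^sup>+c. ennreal p * (case c of (u, v) \<Rightarrow> ennreal (v - u)) \<partial>count_space C)"
      using C(2) p by (intro nn_integral_mono) (auto simp: ennreal_mult'[symmetric] intro!: ennreal_leI)
    also have "\<dots> = ennreal p * (\<integral>\<^sup>+(u, v). ennreal (v - u) \<partial>count_space C)"
      by (simp add: nn_integral_cmult)
    also have "\<dots> = ennreal p * emeasure lebesgue (\<Union>(u, v)\<in>C. {u..v})"
      using C(2) by (subst emeasure_UN_intervals[OF C(1) _ C(3)]) auto
    also have "\<dots> \<le> ennreal p * emeasure lebesgue U"
      using C(2) U(1) by (intro mult_left_mono emeasure_mono) auto
    also have "\<dots> \<le> ennreal p * (m + ennreal \<epsilon>)"
      using Um by (intro mult_left_mono) auto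
    finally show ?thesis .
  qed
  obtain r where r: "r \<ge> 0" "m = ennreal r" using m by (cases m) auto
  have "q * r \<le> p * r + \<epsilon>" if "\<epsilon> > 0" for \<epsilon>
  proof -
    \<comment> \<open>The denominator \<open>p + 1\<close> keeps the error below
      \<open>\<epsilon>\<close> and also covers \<open>p = 0\<close>.\<close>
    have "q * r \<le> p * (r + \<epsilon> / (p + 1))"
      using le[of "\<epsilon> / (p + 1)"] p pq r that
      by (simp add: ennreal_mult'[symmetric] ennreal_plus[symmetric] del: ennreal_plus)
    also have "\<dots> \<le> p * r + \<epsilon>"
      using p that by (simp add: field_simps)
    finally show ?thesis .
  qed
  then have "q * r \<le> p * r" by (rule field_le_epsilon)
  then have "r = 0" using pq r(1) by (metis mult_right_le_imp_le not_le order.order_iff_strict)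
  then show ?thesis
    using negligible_if_outer_measure_of_zero[of S] r(2) by (simp add: m_def)
qed simp

text \<open>Short intervals around points of \<open>S\<close> stay in \<open>(a, b)\<close>, so
  their images lie in \<open>(F a, F b)\<close>. Hence \<open>q\<close> times the outer measure of
  \<open>S\<close> is at most \<open>F b - F a\<close> for every positive \<open>q\<close>.\<close>

lemma negligible_infinite_slopes:
  fixes F :: "real \<Rightarrow> real"
  assumes F: "mono F" and bdd: "S \<subseteq> {a<..<b}"
    and steep: "\<And>q x d. x \<in> S \<Longrightarrow> 0 < d \<Longrightarrow>
      \<exists>u v. u < v \<and> u \<le> x \<and> x \<le> v \<and> v - u < d \<and> q * (v - u) \<le> F v - F u"
  shows "negligible S"
proof (cases "S = {}")
  case False
  then have "a < b" using bdd by fastforce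
  then have Fab: "F a \<le> F b" using F by (simp add: mono_def)
  define m where "m = outer_measure_of lebesgue S"
  have "m < \<infinity>"
    unfolding m_def by (rule finite_outer_measure_of_bounded[of _ a b]) (use bdd in auto)
  then obtain r where r: "r \<ge> 0" "m = ennreal r" by (cases m) auto
  have le: "q * r \<le> F b - F a" if q: "q > 0" for q
  proof -
    have "ennreal q * m \<le> emeasure lebesgue {F a<..<F b}"
      unfolding m_def
    proof (rule emeasure_increments_ge[OF F q])
      fix x d :: real assume x: "x \<in> S" and d: "0 < d"
      then have ab: "a < x" "x < b" using bdd by auto
      obtain u v where uv: "u < v" "u \<le> x" "x \<le> v" "v - u < min d (min (x - a) (b - x))"
        "q * (v - u) \<le> F v - F u"
        using steep[OF x, of "min d (min (x - a) (b - x))" q] d ab by auto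
      then have "a \<le> u" "v \<le> b" by auto
      then have "F a \<le> F u" "F v \<le> F b" using F by (auto simp: mono_def)
      then show "\<exists>u v. u < v \<and> u \<le> x \<and> x \<le> v \<and> v - u < d \<and> q * (v - u) \<le> F v - F u \<and>
          {F u<..<F v} \<subseteq> {F a<..<F b}"
        using uv by (intro exI[of _ u] exI[of _ v]) auto
    qed simp
    then show ?thesis
      using q r Fab by (simp add: ennreal_mult'[symmetric])
  qed
  have "r = 0"
  proof (rule ccontr)
    assume "r \<noteq> 0"
    then have "r > 0" using r(1) by simp
    then show False using le[of "(F b - F a + 1) / r"] Fab by simp
  qed
  then show ?thesis
    using negligible_if_outer_measure_of_zero[of S] r(2) by (simp add: m_def)
qed simp

section \<open>Lebesgue's differentiation theorem for monotone functions\<close>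

text \<open>Intervals having \<open>x\<close> as an end point turn slope bounds into bounds on both
  one-sided difference quotients. Two rationals strictly between their lower and upper limit would
  contradict the dichotomy. The limit is finite by the slope bound from above and by monotonicity
  from below.\<close>

lemma differentiable_if_slopes_converge:
  fixes F :: "real \<Rightarrow> real"
  assumes F: "mono F"
    and bounded: "\<exists>q d. 0 < d \<and> (\<forall>u v. u < v \<and> u \<le> x \<and> x \<le> v \<and> v - u < d \<longrightarrow> F v - F u < q * (v - u))"
    and dichotomy: "\<And>p q. p \<in> \<rat> \<Longrightarrow> q \<in> \<rat> \<Longrightarrow> p < q \<Longrightarrow> \<exists>d>0.
        (\<forall>u v. u < v \<and> u \<le> x \<and> x \<le> v \<and> v - u < d \<longrightarrow> p * (v - u) < F v - F u) \<or>
        (\<forall>u v. u < v \<and> u \<le> x \<and> x \<le> v \<and> v - u < d \<longrightarrow> F v - F u < q * (v - u))"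
  shows "\<exists>D. (F has_real_derivative D) (at x)"
proof -
  define h where "h y = (F (x + y) - F x) / y" for y :: real
  have upper: "\<forall>\<^sub>F y in at 0. h y < q" if "d > 0"
    "\<forall>u v. u < v \<and> u \<le> x \<and> x \<le> v \<and> v - u < d \<longrightarrow> F v - F u < q * (v - u)" for q d
    unfolding eventually_at
  proof (intro exI[of _ d] conjI ballI impI)
    fix y :: real assume y: "y \<noteq> 0 \<and> dist y 0 < d"
    show "h y < q"
    proof (cases "y > 0")
      case True
      then show ?thesis using that(2)[rule_format, of x "x + y"] y by (simp add: h_def field_simps)
    next
      case False
      then show ?thesis using that(2)[rule_format, of "x + y" x] y by (simp add: h_def field_simps)
    qed
  qed fact
  have lower: "\<forall>\<^sub>F y in at 0. p < h y" if "d > 0"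
    "\<forall>u v. u < v \<and> u \<le> x \<and> x \<le> v \<and> v - u < d \<longrightarrow> p * (v - u) < F v - F u" for p d
    unfolding eventually_at
  proof (intro exI[of _ d] conjI ballI impI)
    fix y :: real assume y: "y \<noteq> 0 \<and> dist y 0 < d"
    show "p < h y"
    proof (cases "y > 0")
      case True
      then show ?thesis using that(2)[rule_format, of x "x + y"] y by (simp add: h_def field_simps)
    next
      case False
      then show ?thesis using that(2)[rule_format, of "x + y" x] y by (simp add: h_def field_simps)
    qed
  qed fact
  have h0: "h y \<ge> 0" for y
    using monoD[OF F, of x "x + y"] monoD[OF F, of "x + y" x] by (cases "y \<ge> 0") (auto simp: h_def divide_nonpos_neg divide_nonneg_nonneg)
  let ?L = "Liminf (at 0) (\<lambda>y. ereal (h y))" and ?M = "Limsup (at 0) (\<lambda>y. ereal (h y))"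
  have "?M \<le> ?L"
  proof (rule ccontr)
    assume "\<not> ?M \<le> ?L"
    then obtain c e where ce: "?L < ereal c" "ereal c < ereal e" "ereal e < ?M"
      by (metis ereal_dense2 not_le)
    obtain p where p: "p \<in> \<rat>" "c < p" "p < e" using Rats_dense_in_real[of c e] ce by auto
    obtain q where q: "q \<in> \<rat>" "p < q" "q < e" using Rats_dense_in_real[of p e] p by auto
    obtain d where "d > 0" and d:
      "(\<forall>u v. u < v \<and> u \<le> x \<and> x \<le> v \<and> v - u < d \<longrightarrow> p * (v - u) < F v - F u) \<or>
       (\<forall>u v. u < v \<and> u \<le> x \<and> x \<le> v \<and> v - u < d \<longrightarrow> F v - F u < q * (v - u))"
      using dichotomy[OF p(1) q(1,2)] by blast
    from d show False
    proof
      assume "\<forall>u v. u < v \<and> u \<le> x \<and> x \<le> v \<and> v - u < d \<longrightarrow> p * (v - u) < F v - F u"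
      from lower[OF \<open>d > 0\<close> this] have "ereal p \<le> ?L"
        by (intro Liminf_bounded) (auto elim: eventually_mono)
      then show False using ce(1) p(2) by (metis ereal_less_eq(3) le_less_trans not_le less_imp_le)
    next
      assume "\<forall>u v. u < v \<and> u \<le> x \<and> x \<le> v \<and> v - u < d \<longrightarrow> F v - F u < q * (v - u)"
      from upper[OF \<open>d > 0\<close> this] have "?M \<le> ereal q"
        by (intro Limsup_bounded) (auto elim: eventually_mono)
      then show False using ce(3) q(3) by (metis ereal_less_eq(3) less_le_trans not_le less_imp_le)
    qed
  qed
  then have eq: "?L = ?M" by (intro antisym Liminf_le_Limsup) auto
  have "((\<lambda>y. ereal (h y)) \<longlongrightarrow> ?M) (at 0)"
    by (rule Liminf_eq_Limsup) (use eq in auto)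
  moreover obtain D where "?M = ereal D"
  proof -
    obtain q d where "0 < d" "\<forall>u v. u < v \<and> u \<le> x \<and> x \<le> v \<and> v - u < d \<longrightarrow> F v - F u < q * (v - u)"
      using bounded by blast
    from upper[OF this] have "?M \<le> ereal q"
      by (intro Limsup_bounded) (auto elim: eventually_mono)
    moreover have "ereal 0 \<le> ?L" using h0 by (intro Liminf_bounded) auto
    ultimately show thesis using that eq by (cases ?M) auto
  qed
  ultimately have "(h \<longlongrightarrow> D) (at 0)" by simp
  then show ?thesis
    unfolding DERIV_def h_def by blast
qed

theorem AE_differentiable_mono:
  fixes F :: "real \<Rightarrow> real"
  assumes F: "mono F"
  shows "AE x in lebesgue. \<exists>D. (F has_real_derivative D) (at x)"
proof -
  define flat where "flat p x \<longleftrightarrow>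
    (\<forall>d>0. \<exists>u v. u < v \<and> u \<le> x \<and> x \<le> v \<and> v - u < d \<and> F v - F u \<le> p * (v - u))" for p x
  define steep where "steep q x \<longleftrightarrow>
    (\<forall>d>0. \<exists>u v. u < v \<and> u \<le> x \<and> x \<le> v \<and> v - u < d \<and> q * (v - u) \<le> F v - F u)" for q x
  \<comment> \<open>The negligibility lemmas concern bounded sets, so the line is exhausted by
    bounded windows.\<close>
  let ?J = "\<lambda>n::nat. {- real n<..<real n}"
  have J: "\<exists>n. x \<in> ?J n" for x
    using reals_Archimedean2[of "\<bar>x\<bar>"] by (auto simp: abs_less_iff) (metis minus_less_iff)
  have "negligible ({x. flat p x \<and> steep q x} \<inter> ?J n)" if "p < q" for p q n
    by (rule negligible_oscillating_slopes[OF F that, of _ "- real n" "real n"])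
      (auto simp: flat_def steep_def)
  then have "negligible (\<Union>n. {x. flat p x \<and> steep q x} \<inter> ?J n)" if "p < q" for p q
    using that by (intro negligible_Union_nat)
  then have osc: "AE x in lebesgue. \<not> (flat p x \<and> steep q x)" if "p < q" for p q
    using that J by (intro AE_I'[of "\<Union>n. {x. flat p x \<and> steep q x} \<inter> ?J n"]) (auto simp: negligible_iff_null_sets)
  have "negligible ({x. \<forall>q. steep q x} \<inter> ?J n)" for n
    by (rule negligible_infinite_slopes[OF F, of _ "- real n" "real n"]) (auto simp: steep_def)
  then have "negligible (\<Union>n. {x. \<forall>q. steep q x} \<inter> ?J n)"
    by (intro negligible_Union_nat)
  then have inf: "AE x in lebesgue. \<not> (\<forall>q. steep q x)"
    using J by (intro AE_I'[of "\<Union>n. {x. \<forall>q. steep q x} \<inter> ?J n"]) (auto simp: negligible_iff_null_sets)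
  have "AE x in lebesgue. \<forall>p\<in>\<rat>. \<forall>q\<in>\<rat>. p < q \<longrightarrow> \<not> (flat p x \<and> steep q x)"
    using osc by (simp add: AE_ball_countable countable_rat)
  then show ?thesis
    using inf
  proof eventually_elim
    case (elim x)
    have "\<exists>q d. 0 < d \<and> (\<forall>u v. u < v \<and> u \<le> x \<and> x \<le> v \<and> v - u < d \<longrightarrow> F v - F u < q * (v - u))"
      using elim(2) unfolding steep_def by (meson not_le)
    moreover have "\<exists>d>0.
        (\<forall>u v. u < v \<and> u \<le> x \<and> x \<le> v \<and> v - u < d \<longrightarrow> p * (v - u) < F v - F u) \<or>
        (\<forall>u v. u < v \<and> u \<le> x \<and> x \<le> v \<and> v - u < d \<longrightarrow> F v - F u < q * (v - u))"
      if "p \<in> \<rat>" "q \<in> \<rat>" "p < q" for p q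
      using elim(1) that unfolding flat_def steep_def by (meson not_le)
    ultimately show ?case by (rule differentiable_if_slopes_converge[OF F])
  qed
qed

section \<open>Bregman divergences and subdifferentials\<close>

lemma has_derivative_fgrad:
  assumes "F differentiable (at x)"
  shows "(F has_derivative blinfun_apply (fgrad F x)) (at x)"
proof -
  have d: "(F has_derivative frechet_derivative F (at x)) (at x)"
    using assms frechet_derivative_works by blast
  show ?thesis
    unfolding fgrad_def bounded_linear_Blinfun_apply[OF has_derivative_bounded_linear[OF d]] by (rule d)
qed

lemma bregman_refl [simp]: "bregman F y y = 0"
  by (simp add: bregman_def)

lemma bregman_add_bregman_swap:
  "bregman F z y + bregman F y z = blinfun_apply (fgrad F z - fgrad F y) (z - y)"
  by (simp add: bregman_def blinfun.diff_left blinfun.diff_right)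

text \<open>The three-point identity. With \<open>z\<close> and \<open>z'\<close> on the flow it
  expresses the change of the divergence from \<open>y\<close> through the gradients, whose absolute
  continuity is part of the definition of the flow.\<close>

lemma bregman_diff:
  "bregman F y z - bregman F y z' = blinfun_apply (fgrad F z - fgrad F z') (z - y) - bregman F z z'"
  by (simp add: bregman_def blinfun.diff_left blinfun.diff_right)

lemma blinfun_apply_le_norm:
  fixes \<phi> :: "'a::real_normed_vector \<Rightarrow>\<^sub>L real"
  shows "blinfun_apply \<phi> x \<le> norm \<phi> * norm x"
  using norm_blinfun[of \<phi> x] by simp

lemma conjugate_real_ge:
  assumes "\<bar>conjugate \<Psi> \<phi>\<bar> \<noteq> \<infinity>"
  shows "blinfun_apply \<phi> x - \<Psi> x \<le> conjugate_real \<Psi> \<phi>"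
proof -
  have "ereal (blinfun_apply \<phi> x - \<Psi> x) \<le> conjugate \<Psi> \<phi>"
    unfolding conjugate_def by (rule SUP_upper) simp
  then show ?thesis
    using assms unfolding conjugate_real_def by (cases "conjugate \<Psi> \<phi>") auto
qed

text \<open>Nonnegativity of the divergence means that the supremum in the conjugate is attained at
  \<open>x\<close>: the equality case of Fenchel-Young.\<close>

lemma conjugate_real_fgrad:
  assumes "\<And>z. bregman \<Psi> z x \<ge> 0"
  shows "conjugate_real \<Psi> (fgrad \<Psi> x) = blinfun_apply (fgrad \<Psi> x) x - \<Psi> x"
proof -
  have "conjugate \<Psi> (fgrad \<Psi> x) = ereal (blinfun_apply (fgrad \<Psi> x) x - \<Psi> x)"
    unfolding conjugate_def
  proof (rule SUP_eqI)
    show "ereal (blinfun_apply (fgrad \<Psi> x) z - \<Psi> z) \<le> ereal (blinfun_apply (fgrad \<Psi> x) x - \<Psi> x)" for z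
      using assms[of z] by (simp add: bregman_def blinfun.diff_right)
  qed auto
  then show ?thesis by (simp add: conjugate_real_def)
qed

text \<open>By Fenchel duality the gradient of the conjugate at \<open>\<nabla>\<Psi>(x)\<close> is evaluation at \<open>x\<close>: the
  function \<open>\<phi> \<mapsto> \<Psi>\<^sup>*(\<phi>) - \<langle>\<phi>, x\<rangle>\<close> is minimal there.\<close>

lemma bregman_conjugate_real:
  fixes \<Psi> :: "'a::real_normed_vector \<Rightarrow> real"
  assumes breg: "\<And>z y. bregman \<Psi> z y \<ge> 0"
    and fin: "\<And>\<phi>. \<bar>conjugate \<Psi> \<phi>\<bar> \<noteq> \<infinity>"
    and diff: "conjugate_real \<Psi> differentiable (at (fgrad \<Psi> x))"
  shows "bregman (conjugate_real \<Psi>) (fgrad \<Psi> z) (fgrad \<Psi> x) = bregman \<Psi> x z"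
proof -
  let ?p = "fgrad \<Psi> x"
  have "((\<lambda>\<phi>. conjugate_real \<Psi> \<phi> - blinfun_apply \<phi> x) has_derivative
      (\<lambda>h. blinfun_apply (fgrad (conjugate_real \<Psi>) ?p) h - blinfun_apply h x)) (at ?p)"
    by (intro has_derivative_diff has_derivative_fgrad diff bounded_linear_imp_has_derivative
        blinfun.bounded_linear_left)
  moreover have "\<forall>\<phi>. conjugate_real \<Psi> ?p - blinfun_apply ?p x \<le> conjugate_real \<Psi> \<phi> - blinfun_apply \<phi> x"
    using conjugate_real_ge[OF fin, where x=x] conjugate_real_fgrad[OF breg, of x]
    by (smt (verit))
  ultimately have "(\<lambda>h. blinfun_apply (fgrad (conjugate_real \<Psi>) ?p) h - blinfun_apply h x) = (\<lambda>_. 0)"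
    by (intro differential_zero_maxmin[of ?p UNIV]) auto
  then have "blinfun_apply (fgrad (conjugate_real \<Psi>) ?p) h = blinfun_apply h x" for h
    by (metis eq_iff_diff_eq_0)
  then show ?thesis
    using conjugate_real_fgrad[OF breg, of x] conjugate_real_fgrad[OF breg, of z]
    by (simp add: bregman_def blinfun.diff_left blinfun.diff_right)
qed

section \<open>Frechet subgradients under relative convexity\<close>

text \<open>The subgradient condition is tested along the segment from \<open>x\<close> to
  \<open>y\<close>, where convexity of \<open>\<Phi> - lam * \<Psi>\<close> bounds
  \<open>\<Phi>\<close> from above. After division by \<open>h\<close> and
  \<open>h \<rightarrow> 0\<close>, the directional derivative of \<open>\<Psi>\<close> completes
  the Bregman term.\<close>

lemma frechet_subdifferential_inequality:
  fixes \<Phi> :: "'a::real_normed_vector \<Rightarrow> ereal"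
  assumes conv: "convex_relative lam \<Psi> \<Phi>"
    and not_MInf: "\<And>y. \<Phi> y \<noteq> -\<infinity>"
    and diff: "\<Psi> differentiable (at x)"
    and \<xi>: "\<xi> \<in> frechet_subdifferential \<Phi> x"
    and a: "\<Phi> x = ereal a" and b: "\<Phi> y = ereal b"
  shows "a + blinfun_apply \<xi> (y - x) + lam * bregman \<Psi> y x \<le> b"
proof (cases "y = x")
  case True
  then show ?thesis using a b by simp
next
  case False
  define n where "n = norm (y - x)"
  have n: "n > 0" using False by (simp add: n_def)
  define z where "z h = x + h *\<^sub>R (y - x)" for h :: real
  have z_lim: "filterlim z (at x) (at_right 0)"
    unfolding filterlim_at
  proof
    have "(z \<longlongrightarrow> x + 0 *\<^sub>R (y - x)) (at_right 0)"
      unfolding z_def[abs_def] by (intro tendsto_intros)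
    then show "(z \<longlongrightarrow> x) (at_right 0)" by simp
    show "\<forall>\<^sub>F h in at_right 0. z h \<in> UNIV \<and> z h \<noteq> x"
      unfolding eventually_at_filter using False by (intro always_eventually) (simp add: z_def)
  qed
  have quot: "((\<lambda>h. (\<Psi> (z h) - \<Psi> x) / h) \<longlongrightarrow> blinfun_apply (fgrad \<Psi> x) (y - x)) (at_right 0)"
  proof -
    have "((\<lambda>h. \<Psi> (z h)) has_derivative (\<lambda>h. blinfun_apply (fgrad \<Psi> x) (h *\<^sub>R (y - x)))) (at 0)"
    proof (rule has_derivative_compose[of z "\<lambda>h. h *\<^sub>R (y - x)" 0 UNIV \<Psi> "blinfun_apply (fgrad \<Psi> x)"])
      show "(z has_derivative (\<lambda>h. h *\<^sub>R (y - x))) (at 0)"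
        unfolding z_def[abs_def] by (auto intro!: derivative_eq_intros)
      show "(\<Psi> has_derivative blinfun_apply (fgrad \<Psi> x)) (at (z 0))"
        using has_derivative_fgrad[OF diff] by (simp add: z_def)
    qed
    then have "((\<lambda>h. \<Psi> (z h)) has_real_derivative blinfun_apply (fgrad \<Psi> x) (y - x)) (at 0)"
      by (simp add: has_field_derivative_def blinfun.scaleR_right mult.commute[of _ "blinfun_apply _ _"])
    then have "((\<lambda>h. (\<Psi> (z h) - \<Psi> x) / h) \<longlongrightarrow> blinfun_apply (fgrad \<Psi> x) (y - x)) (at 0)"
      unfolding has_field_derivative_iff by (simp add: z_def)
    then show ?thesis by (rule tendsto_mono[OF at_le[OF subset_UNIV]])
  qed
  have "blinfun_apply \<xi> (y - x) - \<epsilon> \<le> lam * blinfun_apply (fgrad \<Psi> x) (y - x) + (b - a - lam * (\<Psi> y - \<Psi> x))"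
    if \<epsilon>: "\<epsilon> > 0" for \<epsilon>
  proof -
    \<comment> \<open>On the segment the denominator is \<open>h * n\<close>, so the threshold
      \<open>\<epsilon> / n\<close> costs exactly \<open>\<epsilon>\<close> after division by
      \<open>h\<close>.\<close>
    have "ereal (- (\<epsilon> / n)) < Liminf (at x) (\<lambda>y. (\<Phi> y - \<Phi> x - ereal (blinfun_apply \<xi> (y - x))) / ereal (norm (y - x)))"
      using \<xi> \<epsilon> n unfolding frechet_subdifferential_def
      by (rule_tac less_le_trans[of "ereal (- (\<epsilon> / n))" 0]) auto
    then have "\<forall>\<^sub>F y in at x. ereal (- (\<epsilon> / n)) < (\<Phi> y - \<Phi> x - ereal (blinfun_apply \<xi> (y - x))) / ereal (norm (y - x))"
      by (rule less_LiminfD)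
    then have sub: "\<forall>\<^sub>F h in at_right 0. ereal (- (\<epsilon> / n)) <
        (\<Phi> (z h) - \<Phi> x - ereal (blinfun_apply \<xi> (z h - x))) / ereal (norm (z h - x))"
      using z_lim by (auto simp: filterlim_iff)
    have "\<forall>\<^sub>F h in at_right 0. blinfun_apply \<xi> (y - x) - \<epsilon> \<le>
        lam * ((\<Psi> (z h) - \<Psi> x) / h) + (b - a - lam * (\<Psi> y - \<Psi> x))"
      using sub eventually_at_right_real[of 0 1, simplified]
    proof eventually_elim
      case (elim h)
      then have h: "0 < h" "h < 1" by auto
      have zh: "z h = (1 - h) *\<^sub>R x + h *\<^sub>R y" by (simp add: z_def algebra_simps)
      have "\<Phi> (z h) - ereal (lam * \<Psi> (z h)) \<le>
          ereal (1 - h) * (\<Phi> x - ereal (lam * \<Psi> x)) + ereal h * (\<Phi> y - ereal (lam * \<Psi> y))"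
        using conv h unfolding convex_relative_def convex_ereal_def zh by auto
      then obtain c where c: "\<Phi> (z h) = ereal c"
        "c - lam * \<Psi> (z h) \<le> (1 - h) * (a - lam * \<Psi> x) + h * (b - lam * \<Psi> y)"
        using not_MInf[of "z h"] a b by (cases "\<Phi> (z h)") auto
      have "- (\<epsilon> / n) < (c - a - h * blinfun_apply \<xi> (y - x)) / (h * n)"
        using elim(1) h n unfolding c(1) a by (simp add: z_def n_def blinfun.scaleR_right)
      then have "- \<epsilon> * h < c - a - h * blinfun_apply \<xi> (y - x)"
        using h n by (simp add: field_simps)
      then have "h * (blinfun_apply \<xi> (y - x) - \<epsilon>) \<le> lam * (\<Psi> (z h) - \<Psi> x) + h * (b - a - lam * (\<Psi> y - \<Psi> x))"
        using c(2) by (simp add: algebra_simps)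
      also have "\<dots> = h * (lam * ((\<Psi> (z h) - \<Psi> x) / h) + (b - a - lam * (\<Psi> y - \<Psi> x)))"
        using h(1) by (simp add: distrib_left)
      finally show ?case
        by (rule mult_left_le_imp_le[OF _ h(1)])
    qed
    moreover have "((\<lambda>h. lam * ((\<Psi> (z h) - \<Psi> x) / h) + (b - a - lam * (\<Psi> y - \<Psi> x))) \<longlongrightarrow>
        lam * blinfun_apply (fgrad \<Psi> x) (y - x) + (b - a - lam * (\<Psi> y - \<Psi> x))) (at_right 0)"
      by (intro tendsto_intros quot)
    ultimately show ?thesis
      by (intro tendsto_lowerbound[OF _ _ trivial_limit_at_right_real])
  qed
  then have "blinfun_apply \<xi> (y - x) \<le> lam * blinfun_apply (fgrad \<Psi> x) (y - x) + (b - a - lam * (\<Psi> y - \<Psi> x))"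
    by (rule_tac field_le_epsilon) (simp add: algebra_simps)
  then show ?thesis by (simp add: bregman_def algebra_simps)
qed

lemma lower_semicontinuous_eventually_gt:
  assumes "lower_semicontinuous F" "c < F x"
  shows "\<forall>\<^sub>F y in nhds x. c < F y"
proof -
  have "c < Liminf (at x) F"
    using assms unfolding lower_semicontinuous_def by (metis less_le_trans)
  then have "\<forall>\<^sub>F y in at x. c < F y" by (rule less_LiminfD)
  then show ?thesis
    using assms(2) unfolding eventually_at_filter by (auto elim!: eventually_mono)
qed

section \<open>The energy along the flow\<close>

lemma has_vector_derivative_imp_tendsto_quotient:
  assumes "(f has_vector_derivative f') (at t)"
  shows "((\<lambda>s. (f s - f t) /\<^sub>R (s - t)) \<longlongrightarrow> f') (at t)"
proof -
  have "((\<lambda>s. norm (f s - f t - (s - t) *\<^sub>R f') / norm (s - t)) \<longlongrightarrow> 0) (at t)"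
    using assms unfolding has_vector_derivative_def has_derivative_iff_norm by simp
  then have "((\<lambda>s. norm ((f s - f t) /\<^sub>R (s - t) - f')) \<longlongrightarrow> 0) (at t)"
  proof (rule Lim_transform_eventually)
    show "\<forall>\<^sub>F s in at t. norm (f s - f t - (s - t) *\<^sub>R f') / norm (s - t) =
        norm ((f s - f t) /\<^sub>R (s - t) - f')"
      unfolding eventually_at_filter
    proof (intro always_eventually allI impI)
      fix s assume "s \<noteq> t"
      then have "(f s - f t) /\<^sub>R (s - t) - f' = (f s - f t - (s - t) *\<^sub>R f') /\<^sub>R (s - t)"
        by (simp add: scaleR_diff_right)
      then show "norm (f s - f t - (s - t) *\<^sub>R f') / norm (s - t) = norm ((f s - f t) /\<^sub>R (s - t) - f')"
        by (simp add: divide_inverse mult.commute)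
    qed
  qed
  then show ?thesis
    by (rule LIM_zero_cancel[OF tendsto_norm_zero_cancel])
qed

section \<open>Continuity of the flow and the divergence along it\<close>

locale coercive_mirror_flow =
  fixes \<Psi> :: "'a::real_normed_vector \<Rightarrow> real"
    and \<Phi> :: "'a \<Rightarrow> ereal"
    and lam \<alpha> C :: real
    and x :: "real \<Rightarrow> 'a"
  assumes Psi_diff: "\<And>y. \<Psi> differentiable (at y)"
    and Phi_not_MInf: "\<And>y. \<Phi> y \<noteq> -\<infinity>"
    and Phi_lsc: "lower_semicontinuous \<Phi>"
    and Phi_convex: "convex_relative lam \<Psi> \<Phi>"
    and alpha: "\<alpha> > 1"
    and C_pos: "C > 0"
    and Psi_lower: "\<And>y z. norm (z - y) powr \<alpha> \<le> C * bregman \<Psi> z y"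
    and flow: "mirror_flow \<Psi> \<Phi> x"
begin

definition p :: "real \<Rightarrow> ('a \<Rightarrow>\<^sub>L real)" where
  "p t = fgrad \<Psi> (x t)"

lemma bregman_nonneg: "0 \<le> bregman \<Psi> z y"
proof -
  have "0 \<le> C * bregman \<Psi> z y" using Psi_lower[of z y] powr_ge_zero order_trans by blast
  then show ?thesis using C_pos by (simp add: zero_le_mult_iff)
qed

lemma eq_if_bregman_nonpos:
  assumes "bregman \<Psi> z y \<le> 0"
  shows "z = y"
proof -
  have "C * bregman \<Psi> z y \<le> 0" using assms C_pos by (simp add: mult_nonneg_nonpos)
  then have "norm (z - y) powr \<alpha> = 0" using Psi_lower[of z y] powr_ge_zero[of "norm (z - y)" \<alpha>] by linarith
  then show ?thesis by simp
qed

text \<open>Hoelder estimate for the inverse of the gradient. The divergence is at most its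
  symmetrisation, hence at most the norm of the gradient difference times
  \<open>norm (z - y)\<close>; coercivity lets one factor \<open>norm (z - y)\<close> cancel. It
  carries continuity over from \<open>p\<close> to \<open>x\<close>.\<close>

lemma norm_diff_le_powr:
  "norm (z - y) \<le> (C * norm (fgrad \<Psi> z - fgrad \<Psi> y)) powr (1 / (\<alpha> - 1))"
proof (cases "z = y")
  case False
  define n where "n = norm (z - y)"
  have n: "n > 0" using False by (simp add: n_def)
  have "bregman \<Psi> z y \<le> norm (fgrad \<Psi> z - fgrad \<Psi> y) * n"
    using bregman_nonneg[of y z] bregman_add_bregman_swap[of \<Psi> z y]
      blinfun_apply_le_norm[of "fgrad \<Psi> z - fgrad \<Psi> y" "z - y"] by (simp add: n_def)
  then have "n powr \<alpha> \<le> C * (norm (fgrad \<Psi> z - fgrad \<Psi> y) * n)"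
    using Psi_lower[of z y] C_pos unfolding n_def by (meson less_imp_le mult_left_mono order_trans)
  moreover have "n powr \<alpha> = n powr (\<alpha> - 1) * n"
    using n by (simp add: powr_diff)
  ultimately have "n powr (\<alpha> - 1) \<le> C * norm (fgrad \<Psi> z - fgrad \<Psi> y)"
    using n by (simp add: mult.assoc[symmetric])
  then have "(n powr (\<alpha> - 1)) powr (1 / (\<alpha> - 1)) \<le> (C * norm (fgrad \<Psi> z - fgrad \<Psi> y)) powr (1 / (\<alpha> - 1))"
    using alpha by (intro powr_mono2) auto
  then show ?thesis using n alpha by (simp add: powr_powr n_def)
qed simp

lemma abs_cont_p: "0 \<le> a \<Longrightarrow> abs_cont_on a b p"
  using flow unfolding mirror_flow_def p_def[abs_def]
  by (intro abs_cont_on_if_locally_abs_continuous) auto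

lemma isCont_p: "t > 0 \<Longrightarrow> isCont p t"
  using continuous_on_abs_cont_on[OF abs_cont_p[of 0 "t + 1"]]
  by (intro continuous_on_interior[of "{0..t + 1}"]) auto

lemma isCont_x:
  assumes "t > 0"
  shows "isCont x t"
proof -
  have "((\<lambda>s. (C * norm (p s - p t)) powr (1 / (\<alpha> - 1))) \<longlongrightarrow> 0) (at t)"
  proof (rule tendsto_zero_powrI)
    have "((\<lambda>s. C * norm (p s - p t)) \<longlongrightarrow> C * norm (p t - p t)) (at t)"
      using isCont_p[OF assms] unfolding isCont_def by (intro tendsto_intros)
    then show "((\<lambda>s. C * norm (p s - p t)) \<longlongrightarrow> 0) (at t)" by simp
    show "((\<lambda>s. 1 / (\<alpha> - 1)) \<longlongrightarrow> 1 / (\<alpha> - 1)) (at t)" by simp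
  qed (use alpha C_pos in auto)
  then have "((\<lambda>s. norm (x s - x t)) \<longlongrightarrow> 0) (at t)"
    by (rule Lim_null_comparison[rotated])
      (use norm_diff_le_powr in \<open>auto simp: p_def intro: always_eventually\<close>)
  then show ?thesis
    unfolding isCont_def by (rule LIM_zero_cancel[OF tendsto_norm_zero_cancel])
qed

lemma continuous_on_x: "0 < a \<Longrightarrow> continuous_on {a..b} x"
  using isCont_x by (auto intro!: continuous_at_imp_continuous_on)

definition w :: "'a \<Rightarrow> real \<Rightarrow> real" where
  "w y t = bregman \<Psi> y (x t)"

lemma w_diff: "w y t - w y s = blinfun_apply (p t - p s) (x t - y) - bregman \<Psi> (x t) (x s)"
  unfolding w_def p_def by (rule bregman_diff)

lemma abs_cont_w:
  assumes "0 < a"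
  shows "abs_cont_on a b (w y)"
proof -
  have "continuous_on {a..b} (\<lambda>t. x t - y)"
    by (intro continuous_intros continuous_on_x assms)
  then obtain K where K: "K \<ge> 0" "\<And>t. t \<in> {a..b} \<Longrightarrow> norm (x t - y) \<le> K"
    using bounded_on_compact_interval by blast
  \<comment> \<open>The nonnegative divergence in \<open>w_diff\<close> is dropped, leaving a
    one-sided bound. Its right-hand side is symmetric, so exchanging \<open>s\<close> and
    \<open>t\<close> bounds the absolute value.\<close>
  have le: "w y t - w y s \<le> K * norm (p t - p s)" if "t \<in> {a..b}" for s t
  proof -
    have "w y t - w y s \<le> norm (p t - p s) * norm (x t - y)"
      using w_diff[of y t s] bregman_nonneg[of "x t" "x s"] blinfun_apply_le_norm[of "p t - p s" "x t - y"]
      by linarith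
    also have "\<dots> \<le> norm (p t - p s) * K" by (intro mult_left_mono K(2) that) simp
    finally show ?thesis by (simp add: mult.commute)
  qed
  have p: "abs_cont_on a b p" using assms by (intro abs_cont_p) simp
  show ?thesis
  proof (rule abs_cont_on_dominated[OF p p K(1) order_refl])
    fix s t assume "a \<le> s" "s \<le> t" "t \<le> b"
    then show "norm (w y t - w y s) \<le> K * norm (p t - p s) + 0 * norm (p t - p s)"
      using le[of t s] le[of s t] by (simp add: abs_le_iff norm_minus_commute)
  qed
qed

text \<open>The remainder \<open>bregman \<Psi> (x s) (x t)\<close> of the three-point identity is
  at most \<open>norm (p s - p t) * norm (x s - x t)\<close>. Differentiability of \<open>p\<close>
  and mere continuity of \<open>x\<close> make this \<open>o(s - t)\<close>.\<close>

lemma deriv_w: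
  assumes t: "t > 0" and p': "(p has_vector_derivative p') (at t)"
  shows "(w y has_real_derivative blinfun_apply p' (x t - y)) (at t)"
proof -
  define q where "q s = (p s - p t) /\<^sub>R (s - t)" for s
  have q: "(q \<longlongrightarrow> p') (at t)"
    unfolding q_def[abs_def] by (rule has_vector_derivative_imp_tendsto_quotient[OF p'])
  have x: "(x \<longlongrightarrow> x t) (at t)" using isCont_x[OF t] by (simp add: isCont_def)
  have "((\<lambda>s. norm (q s) * norm (x s - x t)) \<longlongrightarrow> norm p' * norm (x t - x t)) (at t)"
    by (intro tendsto_intros q x)
  then have "((\<lambda>s. bregman \<Psi> (x s) (x t) / (s - t)) \<longlongrightarrow> 0) (at t)"
  proof (rule Lim_null_comparison[rotated, OF tendsto_eq_rhs])
    show "\<forall>\<^sub>F s in at t. norm (bregman \<Psi> (x s) (x t) / (s - t)) \<le> norm (q s) * norm (x s - x t)"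
    proof (intro always_eventually allI)
      fix s
      have "bregman \<Psi> (x s) (x t) \<le> norm (p s - p t) * norm (x s - x t)"
        using bregman_add_bregman_swap[of \<Psi> "x s" "x t"] bregman_nonneg[of "x t" "x s"]
          blinfun_apply_le_norm[of "p s - p t" "x s - x t"] by (simp add: p_def)
      then have "\<bar>bregman \<Psi> (x s) (x t)\<bar> / \<bar>s - t\<bar> \<le> norm (p s - p t) * norm (x s - x t) / \<bar>s - t\<bar>"
        using bregman_nonneg[of "x s" "x t"] by (intro divide_right_mono) auto
      then show "norm (bregman \<Psi> (x s) (x t) / (s - t)) \<le> norm (q s) * norm (x s - x t)"
        by (simp add: q_def divide_inverse mult.assoc mult.left_commute mult.commute abs_mult)
    qed
  qed simp
  then have "((\<lambda>s. blinfun_apply (q s) (x s - y) - bregman \<Psi> (x s) (x t) / (s - t))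
      \<longlongrightarrow> blinfun_apply p' (x t - y) - 0) (at t)"
    by (intro tendsto_intros q x)
  moreover have "blinfun_apply (q s) (x s - y) - bregman \<Psi> (x s) (x t) / (s - t) = (w y s - w y t) / (s - t)" for s
    by (simp add: w_diff q_def blinfun.scaleR_left blinfun.diff_left diff_divide_distrib divide_inverse algebra_simps)
  ultimately show ?thesis
    unfolding has_field_derivative_iff by simp
qed

section \<open>Evolution variational inequality and decay of the energy\<close>

definition regular :: "real \<Rightarrow> bool" where
  "regular t \<longleftrightarrow> \<bar>\<Phi> (x t)\<bar> \<noteq> \<infinity> \<and>
     (\<exists>p'. (p has_vector_derivative p') (at t) \<and> - p' \<in> frechet_subdifferential \<Phi> (x t))"

lemma AE_regular: "AE t in lebesgue. t > 0 \<longrightarrow> regular t"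
proof -
  have "AE t in lebesgue. t > 0 \<longrightarrow> (\<exists>p'. (p has_vector_derivative p') (at t) \<and>
      p' \<in> uminus ` frechet_subdifferential \<Phi> (x t))"
    using flow unfolding mirror_flow_def p_def[abs_def] by blast
  then show ?thesis
  proof eventually_elim
    case (elim t)
    have "\<bar>\<Phi> (x t)\<bar> \<noteq> \<infinity>" if "\<xi> \<in> frechet_subdifferential \<Phi> (x t)" for \<xi>
      using that Phi_not_MInf[of "x t"] unfolding frechet_subdifferential_def by auto
    then show ?case using elim unfolding regular_def by fastforce
  qed
qed

text \<open>The subdifferential inequality for the subgradient \<open>- p'\<close>. The integrating
  factor \<open>exp (lam * s)\<close> absorbs the term \<open>lam * w y s\<close>, which leaves a
  bound on a single derivative.\<close>

lemma evolution_variational_inequality: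
  assumes t: "t > 0" "regular t" and y: "\<bar>\<Phi> y\<bar> \<noteq> \<infinity>"
  obtains e where "((\<lambda>s. exp (lam * s) * w y s) has_real_derivative e) (at t)"
    "e \<le> exp (lam * t) * (real_of_ereal (\<Phi> y) - real_of_ereal (\<Phi> (x t)))"
proof -
  obtain p' where p': "(p has_vector_derivative p') (at t)" "- p' \<in> frechet_subdifferential \<Phi> (x t)"
    using t(2) unfolding regular_def by blast
  define a where "a = real_of_ereal (\<Phi> (x t))"
  define b where "b = real_of_ereal (\<Phi> y)"
  have ab: "\<Phi> (x t) = ereal a" "\<Phi> y = ereal b"
    using t(2) y by (auto simp: regular_def a_def b_def ereal_real)
  define d where "d = blinfun_apply p' (x t - y)"
  have "a + blinfun_apply (- p') (y - x t) + lam * w y t \<le> b"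
    unfolding w_def
    by (rule frechet_subdifferential_inequality[OF Phi_convex Phi_not_MInf Psi_diff p'(2) ab])
  moreover have "blinfun_apply (- p') (y - x t) = d"
    by (simp add: d_def blinfun.minus_left blinfun.diff_right)
  ultimately have d: "lam * w y t + d \<le> b - a" by simp
  have "((\<lambda>s. exp (lam * s) * w y s) has_real_derivative exp (lam * t) * (lam * w y t + d)) (at t)"
    by (rule derivative_eq_intros refl deriv_w[OF t(1) p'(1), of y, folded d_def])+
      (simp add: algebra_simps)
  moreover have "exp (lam * t) * (lam * w y t + d) \<le> exp (lam * t) * (b - a)"
    using d by (intro mult_left_mono) auto
  ultimately show thesis using that by (simp add: a_def b_def)
qed

lemma abs_cont_exp_w:
  assumes "0 < a"
  shows "abs_cont_on a b (\<lambda>s. exp (lam * s) * w y s)"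
proof (rule abs_cont_on_mult[OF _ abs_cont_w[OF assms]])
  show "abs_cont_on a b (\<lambda>s. exp (lam * s))"
    by (rule abs_cont_on_C1[of _ "\<lambda>s. exp (lam * s) * lam"])
      (auto intro!: derivative_eq_intros continuous_intros)
qed

text \<open>If \<open>\<Phi>(x\<^sub>s) < c < \<Phi>(x\<^sub>t)\<close>, let \<open>a\<close> be the last time before \<open>t\<close> with \<open>\<Phi>(x\<^sub>a) \<le> c\<close>. The
  variational inequality for \<open>y = x\<^sub>a\<close> forces the flow to be constant after \<open>a\<close>.\<close>

lemma Phi_nonincreasing:
  assumes s: "0 < s" and st: "s \<le> t" and fin: "\<Phi> (x s) \<noteq> \<infinity>"
  shows "\<Phi> (x t) \<le> \<Phi> (x s)"
proof (rule ccontr)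
  assume "\<not> \<Phi> (x t) \<le> \<Phi> (x s)"
  then obtain c where c: "\<Phi> (x s) < ereal c" "ereal c < \<Phi> (x t)"
    by (metis ereal_dense2 not_le)
  \<comment> \<open>Lower semicontinuity of \<open>\<Phi>\<close> and continuity of \<open>x\<close>
    make this set of times compact, so that a last one exists.\<close>
  define S where "S = {r \<in> {s..t}. \<Phi> (x r) \<le> ereal c}"
  have "closed S"
    unfolding closed_def open_dist
  proof
    fix r assume r: "r \<in> - S"
    show "\<exists>e>0. \<forall>r'. dist r' r < e \<longrightarrow> r' \<in> - S"
    proof (cases "r \<in> {s..t}")
      case True
      then have "ereal c < \<Phi> (x r)" using r by (auto simp: S_def)
      then have "\<forall>\<^sub>F y in nhds (x r). ereal c < \<Phi> y"
        by (rule lower_semicontinuous_eventually_gt[OF Phi_lsc])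
      moreover have "filterlim x (nhds (x r)) (nhds r)"
        using isCont_x[of r] True s by (simp add: continuous_at_imp_continuous_at_within tendsto_nhds_iff isCont_def)
      ultimately have "\<forall>\<^sub>F r' in nhds r. ereal c < \<Phi> (x r')"
        unfolding filterlim_iff by blast
      then show ?thesis
        unfolding eventually_nhds_metric S_def by (auto simp: not_le)
    next
      case False
      then have "r \<in> - {s..t}" "open (- {s..t})" by auto
      then obtain e where "e > 0" "\<forall>r'. dist r' r < e \<longrightarrow> r' \<in> - {s..t}"
        unfolding open_dist by blast
      then show ?thesis by (auto simp: S_def)
    qed
  qed
  moreover have "s \<in> S" "bounded S"
    using c(1) st by (auto simp: S_def intro: bounded_subset[of "{s..t}"])
  ultimately obtain a where a: "a \<in> S" "\<And>r. r \<in> S \<Longrightarrow> r \<le> a"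
    using compact_attains_sup[of S] by (auto simp: compact_eq_bounded_closed)
  have aS: "s \<le> a" "\<Phi> (x a) \<le> ereal c" "a < t"
    using a(1) c(2) by (auto simp: S_def order.strict_iff_order)
  have above: "ereal c < \<Phi> (x r)" if "a < r" "r \<le> t" for r
    using a(2)[of r] that aS(1) by (force simp: S_def)
  have fa: "\<bar>\<Phi> (x a)\<bar> \<noteq> \<infinity>"
    using aS(2) Phi_not_MInf[of "x a"] by auto
  have "exp (lam * t) * w (x a) t \<le> exp (lam * a) * w (x a) a"
  proof (rule abs_cont_on_nonincreasing[of a t "\<lambda>r. exp (lam * r) * w (x a) r"])
    show "abs_cont_on a t (\<lambda>r. exp (lam * r) * w (x a) r)"
      using s aS(1) by (intro abs_cont_exp_w) simp
    show "AE r in lebesgue. a < r \<longrightarrow> r < t \<longrightarrow>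
        (\<exists>d\<le>0. ((\<lambda>r. exp (lam * r) * w (x a) r) has_real_derivative d) (at r))"
      using AE_regular
    proof eventually_elim
      case (elim r)
      show ?case
      proof (intro impI)
        assume r: "a < r" "r < t"
        then have "0 < r" "regular r" using elim s aS(1) by auto
        then obtain e where e: "((\<lambda>s. exp (lam * s) * w (x a) s) has_real_derivative e) (at r)"
          "e \<le> exp (lam * r) * (real_of_ereal (\<Phi> (x a)) - real_of_ereal (\<Phi> (x r)))"
          using evolution_variational_inequality[OF _ _ fa] by blast
        have "\<Phi> (x a) \<le> \<Phi> (x r)"
          using aS(2) above[of r] r by (meson less_imp_le order_trans)
        then have "real_of_ereal (\<Phi> (x a)) \<le> real_of_ereal (\<Phi> (x r))"
          using fa \<open>regular r\<close> by (cases "\<Phi> (x a)"; cases "\<Phi> (x r)") (auto simp: regular_def)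
        then have "e \<le> 0"
          using e(2) by (simp add: mult_nonneg_nonpos order_trans)
        then show "\<exists>d\<le>0. ((\<lambda>r. exp (lam * r) * w (x a) r) has_real_derivative d) (at r)"
          using e(1) by blast
      qed
    qed
  qed (use aS in simp)
  \<comment> \<open>The weighted divergence starts at \<open>w (x a) a = 0\<close> and does not
    increase.\<close>
  then have "bregman \<Psi> (x a) (x t) \<le> 0" by (simp add: w_def mult_le_0_iff)
  then have "x a = x t" by (rule eq_if_bregman_nonpos)
  then show False using aS(2) c(2) by simp
qed

text \<open>Regular times have full measure, so one precedes \<open>t\<close>; monotonicity
  propagates finiteness from there.\<close>

lemma Phi_finite:
  assumes "t > 0"
  shows "\<bar>\<Phi> (x t)\<bar> \<noteq> \<infinity>"
proof -
  have "\<exists>s. 0 < s \<and> s < t \<and> regular s"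
  proof (rule ccontr)
    assume "\<not> ?thesis"
    then have "AE s in lebesgue. s \<notin> {0<..<t}"
      using AE_regular by (auto elim: eventually_mono)
    then have "{0<..<t} \<in> null_sets lebesgue"
      by (simp add: AE_iff_null_sets)
    then show False using assms by (simp add: null_sets_def)
  qed
  then obtain s where "0 < s" "s < t" "regular s" by blast
  then have "\<Phi> (x t) \<le> \<Phi> (x s)" "\<bar>\<Phi> (x s)\<bar> \<noteq> \<infinity>"
    using Phi_nonincreasing[of s t] by (auto simp: regular_def)
  then show ?thesis using Phi_not_MInf[of "x t"] by auto
qed

section \<open>Differentiability of the energy and its rate of dissipation\<close>

definition f :: "real \<Rightarrow> real" where
  "f t = real_of_ereal (\<Phi> (x t))"

lemma f_nonincreasing: "0 < s \<Longrightarrow> s \<le> t \<Longrightarrow> f t \<le> f s"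
  using Phi_nonincreasing[of s t] Phi_finite[of s] Phi_finite[of t]
  by (cases "\<Phi> (x s)"; cases "\<Phi> (x t)") (auto simp: f_def)

lemma AE_differentiable_f: "AE t in lebesgue. t > 0 \<longrightarrow> (\<exists>d. (f has_real_derivative d) (at t))"
proof -
  \<comment> \<open>Monotonicity of \<open>f\<close> is known at positive times only. Freezing the
    argument below \<open>1 / (n + 1)\<close> gives functions monotone on the whole line, and every
    positive time is seen by one of these countably many.\<close>
  define F where "F n t = - f (max (1 / real (Suc n)) t)" for n t
  have "mono (F n)" for n
    unfolding F_def by (intro monoI) (auto intro!: f_nonincreasing simp: less_max_iff_disj)
  then have "AE t in lebesgue. \<forall>n. \<exists>d. (F n has_real_derivative d) (at t)"
    unfolding AE_all_countable by (blast intro: AE_differentiable_mono)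
  then show ?thesis
  proof eventually_elim
    case (elim t)
    show ?case
    proof
      assume "t > 0"
      then obtain n where n: "1 / real (Suc n) < t"
        using nat_approx_posE by blast
      obtain d where "(F n has_real_derivative d) (at t)" using elim by blast
      then have "((\<lambda>t. - F n t) has_real_derivative - d) (at t)"
        by (rule DERIV_minus)
      then have "(f has_real_derivative - d) (at t)"
      proof (rule has_field_derivative_transform_within_open)
        show "open {1 / real (Suc n)<..}" "t \<in> {1 / real (Suc n)<..}" using n by auto
        show "- F n s = f s" if "s \<in> {1 / real (Suc n)<..}" for s
          using that by (simp add: F_def max_def)
      qed
      then show "\<exists>d. (f has_real_derivative d) (at t)" by blast
    qed
  qed
qed

text \<open>The sharp constant is \<open>1/2\<close>; the lost factor \<open>2\<close> absorbs \<open>e\<^bsup>\<bar>\<lambda>\<bar>(t - s)\<^esup>\<close>.\<close>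

lemma bregman_le_quadratic:
  assumes s: "s > 0" and d: "(f has_real_derivative d) (at s)" and \<epsilon>: "\<epsilon> > 0"
  shows "\<forall>\<^sub>F t in at_right s. bregman \<Psi> (x s) (x t) \<le> (\<epsilon> - d) * (t - s)\<^sup>2"
proof -
  define D where "D = \<epsilon> - d"
  obtain \<delta> where \<delta>: "\<delta> > 0" "\<And>r. \<bar>r - s\<bar> < \<delta> \<Longrightarrow> \<bar>f r - f s - d * (r - s)\<bar> \<le> \<epsilon> * \<bar>r - s\<bar>"
    using d[unfolded has_field_derivative_def has_derivative_within_alt, simplified] \<epsilon> by blast
  \<comment> \<open>The first bound is monotonicity, the second the first-order expansion of
    \<open>f\<close> at \<open>s\<close>.\<close>
  have drop: "0 \<le> f s - f r" "f s - f r \<le> D * (r - s)" if "s \<le> r" "r < s + \<delta>" for r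
    using \<delta>(2)[of r] that f_nonincreasing[of s r] s by (auto simp: D_def algebra_simps abs_le_iff)
  have "((\<lambda>t. exp (\<bar>lam\<bar> * (t - s))) \<longlongrightarrow> exp (\<bar>lam\<bar> * (s - s))) (at_right s)"
    by (intro tendsto_intros)
  then have "\<forall>\<^sub>F t in at_right s. exp (\<bar>lam\<bar> * (t - s)) < 2"
    by (intro order_tendstoD(2)) auto
  moreover have "\<forall>\<^sub>F t in at_right s. t \<in> {s<..<s + \<delta>}"
    using \<delta>(1) by (intro eventually_at_right_real) simp
  ultimately show ?thesis
  proof eventually_elim
    case (elim t)
    then have t: "s < t" "t < s + \<delta>" by auto
    have D: "D \<ge> 0" using drop[of t] t by (smt (verit) mult_neg_pos)
    \<comment> \<open>An upper bound for the integrating factor on \<open>{s..t}\<close>, valid for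
      either sign of \<open>lam\<close>.\<close>
    define M where "M = exp (lam * t) * exp (\<bar>lam\<bar> * (t - s))"
    have M: "exp (lam * r) \<le> M" if "s \<le> r" "r \<le> t" for r
    proof -
      have "lam * (r - t) \<le> \<bar>lam\<bar> * (t - s)"
      proof -
        have "lam * (r - t) \<le> \<bar>lam\<bar> * \<bar>r - t\<bar>" by (metis abs_ge_self abs_mult)
        also have "\<dots> \<le> \<bar>lam\<bar> * (t - s)" using that by (intro mult_left_mono) auto
        finally show ?thesis .
      qed
      then have "lam * r \<le> lam * t + \<bar>lam\<bar> * (t - s)" by (simp add: algebra_simps)
      then show ?thesis by (simp add: M_def exp_add[symmetric])
    qed
    \<comment> \<open>The subtracted term is the primitive of the bound
      \<open>M * D * (r - s)\<close> on the derivative of the weighted divergence; both terms vanish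
      at \<open>r = s\<close>.\<close>
    let ?u = "\<lambda>r. exp (lam * r) * w (x s) r - M * D * (r - s)\<^sup>2 / 2"
    have "?u t \<le> ?u s"
    proof (rule abs_cont_on_nonincreasing[of s t])
      have "abs_cont_on s t (\<lambda>r. M * D * (r - s)\<^sup>2 / 2)"
        by (rule abs_cont_on_C1[of _ "\<lambda>r. M * D * (r - s)"])
          (auto intro!: derivative_eq_intros continuous_intros)
      then show "abs_cont_on s t ?u"
        by (intro abs_cont_on_diff abs_cont_exp_w[OF s])
      show "AE r in lebesgue. s < r \<longrightarrow> r < t \<longrightarrow> (\<exists>d\<le>0. (?u has_real_derivative d) (at r))"
        using AE_regular
      proof eventually_elim
        case (elim r)
        show ?case
        proof (intro impI)
          assume r: "s < r" "r < t"
          then have "0 < r" "regular r" using elim s by auto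
          then obtain e where e: "((\<lambda>r. exp (lam * r) * w (x s) r) has_real_derivative e) (at r)"
            "e \<le> exp (lam * r) * (f s - f r)"
            using evolution_variational_inequality[OF _ _ Phi_finite[OF s]] unfolding f_def by blast
          have "(?u has_real_derivative e - M * D * (r - s)) (at r)"
          proof (rule DERIV_diff[OF e(1)])
            show "((\<lambda>r. M * D * (r - s)\<^sup>2 / 2) has_real_derivative M * D * (r - s)) (at r)"
              by (auto intro!: derivative_eq_intros)
          qed
          moreover have "exp (lam * r) * (f s - f r) \<le> M * (D * (r - s))"
            using M[of r] drop[of r] r t by (intro mult_mono) (auto simp: M_def)
          ultimately show "\<exists>d\<le>0. (?u has_real_derivative d) (at r)"
            using e(2) by (intro exI[of _ "e - M * D * (r - s)"]) (auto simp: mult.assoc)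
        qed
      qed
    qed (use t in simp)
    then have "exp (lam * t) * w (x s) t \<le> exp (lam * t) * (exp (\<bar>lam\<bar> * (t - s)) * D * (t - s)\<^sup>2 / 2)"
      by (simp add: M_def w_def mult.assoc)
    then have "w (x s) t \<le> exp (\<bar>lam\<bar> * (t - s)) * (D * (t - s)\<^sup>2 / 2)"
      by simp
    also have "\<dots> \<le> 2 * (D * (t - s)\<^sup>2 / 2)"
      using elim D by (intro mult_right_mono) auto
    finally show ?case by (simp add: w_def D_def)
  qed
qed

lemma energy_dissipation:
  assumes g_cont: "continuous_on {0<..} g" and g_0: "filterlim g at_top (at_right 0)"
    and lower: "\<And>z y. extend_at_0 g (norm (fgrad \<Psi> z) + norm (fgrad \<Psi> y)) *
      ereal ((norm (fgrad \<Psi> z - fgrad \<Psi> y))\<^sup>2) \<le> ereal (bregman \<Psi> y z)"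
    and s: "s > 0" and d: "(f has_real_derivative d) (at s)"
    and p': "(p has_vector_derivative p') (at s)"
  shows "extend_at_0 g (2 * norm (p s)) * ereal ((norm p')\<^sup>2) \<le> ereal (- d)"
proof -
  define q where "q t = (p t - p s) /\<^sub>R (t - s)" for t
  have "(q \<longlongrightarrow> p') (at s)"
    unfolding q_def[abs_def] by (rule has_vector_derivative_imp_tendsto_quotient[OF p'])
  then have q: "(q \<longlongrightarrow> p') (at_right s)"
    by (rule tendsto_mono[OF at_le[OF subset_UNIV]])
  have "(p \<longlongrightarrow> p s) (at s)" using isCont_p[OF s] by (simp add: isCont_def)
  then have p: "(p \<longlongrightarrow> p s) (at_right s)"
    by (rule tendsto_mono[OF at_le[OF subset_UNIV]])
  \<comment> \<open>The quadratic bound meets \<open>lower\<close> and is divided by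
    \<open>(t - s)^2\<close>. The guard excludes the argument 0, where the weight is infinite rather
    than a value of \<open>g\<close>.\<close>
  have main: "\<forall>\<^sub>F t in at_right s. norm (p t) + norm (p s) > 0 \<longrightarrow>
      g (norm (p t) + norm (p s)) * (norm (q t))\<^sup>2 \<le> \<epsilon> - d" if \<epsilon>: "\<epsilon> > 0" for \<epsilon>
    using bregman_le_quadratic[OF s d \<epsilon>] eventually_at_right_less[of s]
  proof eventually_elim
    case (elim t)
    show ?case
    proof
      assume pos: "norm (p t) + norm (p s) > 0"
      have "p t - p s = (t - s) *\<^sub>R q t" using elim(2) by (simp add: q_def)
      then have "(norm (p t - p s))\<^sup>2 = (norm (q t))\<^sup>2 * (t - s)\<^sup>2"
        by (simp add: power_mult_distrib)
      moreover have "g (norm (p t) + norm (p s)) * (norm (p t - p s))\<^sup>2 \<le> bregman \<Psi> (x s) (x t)"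
        using lower[of "x t" "x s"] pos by (simp add: extend_at_0_def p_def)
      ultimately have "(g (norm (p t) + norm (p s)) * (norm (q t))\<^sup>2) * (t - s)\<^sup>2 \<le> (\<epsilon> - d) * (t - s)\<^sup>2"
        using elim(1) by (simp add: mult.assoc)
      then show "g (norm (p t) + norm (p s)) * (norm (q t))\<^sup>2 \<le> \<epsilon> - d"
        using elim(2) by simp
    qed
  qed
  show ?thesis
  proof (cases "p s = 0")
    case False
    then have pos: "norm (p s) > 0" by simp
    have "isCont g (2 * norm (p s))"
      using g_cont pos by (intro continuous_on_interior[of "{0<..}"]) (auto simp: interior_open)
    moreover have "((\<lambda>t. norm (p t) + norm (p s)) \<longlongrightarrow> 2 * norm (p s)) (at_right s)"
      unfolding mult_2 by (intro tendsto_intros p)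
    ultimately have "((\<lambda>t. g (norm (p t) + norm (p s))) \<longlongrightarrow> g (2 * norm (p s))) (at_right s)"
      by (rule isCont_tendsto_compose)
    then have lim: "((\<lambda>t. g (norm (p t) + norm (p s)) * (norm (q t))\<^sup>2) \<longlongrightarrow>
        g (2 * norm (p s)) * (norm p')\<^sup>2) (at_right s)"
      by (intro tendsto_intros q)
    have "g (2 * norm (p s)) * (norm p')\<^sup>2 \<le> - d + \<epsilon>" if \<epsilon>: "\<epsilon> > 0" for \<epsilon>
    proof (rule tendsto_upperbound[OF lim _ trivial_limit_at_right_real])
      show "\<forall>\<^sub>F t in at_right s. g (norm (p t) + norm (p s)) * (norm (q t))\<^sup>2 \<le> - d + \<epsilon>"
        using main[OF \<epsilon>] pos by (auto elim!: eventually_mono simp: add_nonneg_pos)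
    qed
    then have "g (2 * norm (p s)) * (norm p')\<^sup>2 \<le> - d" by (rule field_le_epsilon)
    then show ?thesis using False by (simp add: extend_at_0_def)
  next
    \<comment> \<open>The weight in the claim is infinite here. A nonzero \<open>p'\<close> would
      drive the left-hand side of \<open>main\<close> to infinity, so \<open>p' = 0\<close>; since
      infinity times 0 is 0, it remains to show \<open>d \<le> 0\<close>.\<close>
    case p0: True
    have "p' = 0"
    proof (rule ccontr)
      assume "p' \<noteq> 0"
      then have "\<forall>\<^sub>F t in at_right s. q t \<noteq> 0"
        by (rule tendsto_imp_eventually_ne[OF q])
      then have ne: "\<forall>\<^sub>F t in at_right s. norm (p t) > 0"
        by (auto elim!: eventually_mono simp: q_def p0)
      have "((\<lambda>t. norm (p t)) \<longlongrightarrow> 0) (at_right s)"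
        using p p0 tendsto_norm_zero by fastforce
      then have "filterlim (\<lambda>t. norm (p t)) (at_right 0) (at_right s)"
        using ne by (auto simp: filterlim_at elim: eventually_mono)
      then have "filterlim (\<lambda>t. g (norm (p t))) at_top (at_right s)"
        by (rule filterlim_compose[OF g_0])
      moreover have "((\<lambda>t. (norm (q t))\<^sup>2) \<longlongrightarrow> (norm p')\<^sup>2) (at_right s)"
        by (intro tendsto_intros q)
      ultimately have "filterlim (\<lambda>t. g (norm (p t)) * (norm (q t))\<^sup>2) at_top (at_right s)"
        using \<open>p' \<noteq> 0\<close> by (intro filterlim_at_top_mult_tendsto_pos[where c="(norm p')\<^sup>2"]) auto
      then have "\<forall>\<^sub>F t in at_right s. 1 - d < g (norm (p t)) * (norm (q t))\<^sup>2"
        by (simp add: filterlim_at_top_dense)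
      then have "\<forall>\<^sub>F t in at_right s. False"
        using main[OF zero_less_one] ne by eventually_elim (simp add: p0)
      then show False by simp
    qed
    \<comment> \<open>A nonnegative divergence below \<open>(\<epsilon> - d) * (t - s)^2\<close>
      forces this sign.\<close>
    moreover have "d \<le> \<epsilon>" if \<epsilon>: "\<epsilon> > 0" for \<epsilon>
    proof -
      obtain t where "s < t" "bregman \<Psi> (x s) (x t) \<le> (\<epsilon> - d) * (t - s)\<^sup>2"
        using eventually_happens'[OF _ eventually_conj[OF eventually_at_right_less[of s] bregman_le_quadratic[OF s d \<epsilon>]]]
        by auto
      then have "0 \<le> (\<epsilon> - d) * (t - s)\<^sup>2" "(t - s)\<^sup>2 > 0"
        using bregman_nonneg[of "x s" "x t"] by auto
      then show ?thesis by (simp add: zero_le_mult_iff)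
    qed
    then have "d \<le> 0" using field_le_epsilon[of d 0] by simp
    ultimately show ?thesis by (simp add: zero_ereal_def[symmetric])
  qed
qed

end

section \<open>The dissipation inequality for mirror flows\<close>

theorem theorem1p5:
  fixes \<Psi> :: "'a::banach \<Rightarrow> real"
    and \<Phi> :: "'a \<Rightarrow> ereal"
    and lam \<alpha> C :: real
    and g :: "real \<Rightarrow> real"
    and x :: "real \<Rightarrow> 'a"
  assumes RNP: "radon_nikodym_property TYPE('a \<Rightarrow>\<^sub>L real)"
    and Psi_nonneg: "\<And>y. \<Psi> y \<ge> 0"
    and Psi_convex: "convex_on UNIV \<Psi>"
    and Psi_C1: "C1_functional \<Psi>"
    and conj_finite: "\<And>\<phi>. \<bar>conjugate \<Psi> \<phi>\<bar> \<noteq> \<infinity>"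
    and conj_C1: "C1_functional (conjugate_real \<Psi>)"
    and Phi_not_MInf: "\<And>y. \<Phi> y \<noteq> -\<infinity>"
    and Phi_proper: "\<exists>y. \<Phi> y \<noteq> \<infinity>"
    and Phi_lsc: "lower_semicontinuous \<Phi>"
    and Phi_convex: "convex_relative lam \<Psi> \<Phi>"
    and alpha: "\<alpha> > 1"
    and C_pos: "C > 0"
    and Psi_lower: "\<And>y z. norm (z - y) powr \<alpha> \<le> C * bregman \<Psi> z y"
    and g_cont: "continuous_on {0<..} g"
    and g_pos: "\<And>r. r > 0 \<Longrightarrow> g r > 0"
    and g_0: "filterlim g at_top (at_right 0)"
    and conj_lower: "\<And>\<phi> \<psi>. extend_at_0 g (norm \<phi> + norm \<psi>) * ereal ((norm (\<phi> - \<psi>))\<^sup>2)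
                       \<le> ereal (bregman (conjugate_real \<Psi>) \<phi> \<psi>)"
    and flow: "mirror_flow \<Psi> \<Phi> x"
  shows "AE t in lebesgue. t > 0 \<longrightarrow>
           (\<exists>d p. has_ereal_derivative (\<lambda>s. \<Phi> (x s)) d t \<and>
                  ((\<lambda>s. fgrad \<Psi> (x s)) has_vector_derivative p) (at t) \<and>
                  ereal (- d) \<ge> extend_at_0 g (2 * norm (fgrad \<Psi> (x t))) * ereal ((norm p)\<^sup>2))"
proof -
  interpret coercive_mirror_flow \<Psi> \<Phi> lam \<alpha> C x
    using Psi_C1 Phi_not_MInf Phi_lsc Phi_convex alpha C_pos Psi_lower flow
    by unfold_locales (auto simp: C1_functional_def)
  have "conjugate_real \<Psi> differentiable (at \<phi>)" for \<phi>
    using conj_C1 by (simp add: C1_functional_def)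
  \<comment> \<open>Duality exchanges the two arguments of the divergence.\<close>
  then have lower: "extend_at_0 g (norm (fgrad \<Psi> z) + norm (fgrad \<Psi> y)) *
      ereal ((norm (fgrad \<Psi> z - fgrad \<Psi> y))\<^sup>2) \<le> ereal (bregman \<Psi> y z)" for z y
    using conj_lower[of "fgrad \<Psi> z" "fgrad \<Psi> y"]
      bregman_conjugate_real[of \<Psi> y z, OF bregman_nonneg conj_finite] by simp
  show ?thesis
    using AE_regular AE_differentiable_f
  proof eventually_elim
    case (elim t)
    show ?case
    proof
      assume t: "t > 0"
      obtain d where d: "(f has_real_derivative d) (at t)" using elim t by blast
      obtain p' where p': "(p has_vector_derivative p') (at t)"
        using elim t by (auto simp: regular_def)
      have "\<forall>\<^sub>F s in nhds t. \<bar>\<Phi> (x s)\<bar> \<noteq> \<infinity>"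
        by (rule eventually_mono[OF eventually_nhds_in_open[of "{0<..}"]])
          (simp_all only: t open_greaterThan greaterThan_iff Phi_finite not_False_eq_True)
      then have "has_ereal_derivative (\<lambda>s. \<Phi> (x s)) d t"
        using d by (simp add: has_ereal_derivative_def f_def[abs_def])
      moreover have "ereal (- d) \<ge> extend_at_0 g (2 * norm (p t)) * ereal ((norm p')\<^sup>2)"
        by (rule energy_dissipation[OF g_cont g_0 lower t d p'])
      ultimately show "\<exists>d p. has_ereal_derivative (\<lambda>s. \<Phi> (x s)) d t \<and>
          ((\<lambda>s. fgrad \<Psi> (x s)) has_vector_derivative p) (at t) \<and>
          ereal (- d) \<ge> extend_at_0 g (2 * norm (fgrad \<Psi> (x t))) * ereal ((norm p)\<^sup>2)"
        using p' unfolding p_def[abs_def] by blast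
    qed
  qed
qed

end
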